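(* Consider the multi-type Galton-Watson tree and the normal, misère and escape games on it, with notation as in the context. (i) For each $j\in[m]$: $\mathrm{nw}_{1,j}\le\mathrm{esw}_j$, $\mathrm{nl}_{2,j}\le\mathrm{eel}_j$, $\mathrm{mw}_{1,j}\le\mathrm{esw}_j$ and $\mathrm{ml}_{2,j}\le\mathrm{eel}_j$. (ii) Suppose $G_{j,S_j}$ and $G_{j,[m]\setminus S_j}$ are differentiable for every $j\in[m]$. Then for every $j\in[m]$, writing $e_j=\min\{\mathrm{eel}_t:t\in S_j\}$, $a_j=\min\{\mathrm{ml}_{2,t}:t\in S_j\}$ and $c_j=\min\{\mathrm{ml}_{1,t}:t\in[m]\setminus S_j\}$, $$\mathrm{esw}_j\ \ge\ \alpha_j+e_j(1-\alpha_j)+\sum_{k\in S_j}(\mathrm{eel}_k-e_j)\,\partial_kG_{j,S_j}(1-\mathrm{eel}_t:t\in S_j)\ \ge\ e_j,$$ $$\mathrm{mw}_{1,j}\ \ge\ \alpha_j+a_j(1-\alpha_j)+\sum_{k\in S_j}(\mathrm{ml}_{2,k}-a_j)\,\partial_kG_{j,S_j}(1-\mathrm{ml}_{2,t}:t\in S_j)\ \ge\ a_j,$$ $$\mathrm{mw}_{2,j}\ \ge\ \beta_j+c_j(1-\beta_j)+\sum_{k\in[m]\setminus S_j}(\mathrm{ml}_{1,k}-c_j)\,\partial_kG_{j,[m]\setminus S_j}(1-\mathrm{ml}_{1,t}:t\in[m]\setminus S_j)\ \ge\ c_j.$$ (iii) Suppose that, for every $j\in[m]$, $G_{j,S_j}$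 is convex and continuously differentiable and $G_{j,[m]\setminus S_j}$ is continuous. If for each $j\in[m]$ $$\alpha_j\le\sum_{i\in S_j}\beta_i\,\mathbf{P}\big[X_{v,i}=1,\ X_{v,k}=0\text{ for all }k\in S_j\setminus\{i\}\,\big|\,\sigma(v)=j\big],$$ then $\mathbf{nl}_1\preceq\mathbf{ml}_1$. If for each $j\in[m]$ $$\alpha_j\ge\sum_{i\in S_j}\beta_i\,\mathbf{E}\big[X_{v,i}\,\big|\,\sigma(v)=j\big],$$ then $\mathbf{nw}_1\preceq\mathbf{mw}_1$. Analogously, suppose that, for every $j\in[m]$, $G_{j,[m]\setminus S_j}$ is convex and continuously differentiable and $G_{j,S_j}$ is continuous. If for each $j\in[m]$ $$\beta_j\le\sum_{i\in[m]\setminus S_j}\alpha_i\,\mathbf{P}\big[X_{v,i}=1,\ X_{v,k}=0\text{ for all }k\in([m]\setminus S_j)\setminus\{i\}\,\big|\,\sigma(v)=j\big],$$ then $\mathbf{nl}_2\preceq\mathbf{ml}_2$. If for each $j\in[m]$, $\beta_j\ge\sum_{i\in[m]\setminus S_j}\alpha_i\,\mathbf{E}[X_{v,i}\,|\,\sigma(v)=j]$, then $\mathbf{nw}_2\preceq\mathbf{mw}_2$.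
   Context: Tree. $[m]=\{1,\ldots,m\}$ is a finite set of colours, $\mathbf{p}=(p_1,\ldots,p_m)$ a probability vector, and $\chi_1,\ldots,\chi_m$ probability distributions on $\mathbb{N}_0^m$. The rooted multi-type Galton-Watson tree $\mathcal{T}$ is generated as follows: the root $\phi$ gets a colour $\sigma(\phi)\in[m]$ according to $\mathbf{p}$; then every vertex $v$ with colour $\sigma(v)=i$ gives birth, independently of all else, to $X_{v,j}$ children of colour $j$ for all $j\in[m]$, where $(X_{v,1},\ldots,X_{v,m})\sim\chi_i$. Edges $(u,v)$ are directed from parent $u$ to child $v$. Games. For each $j\in[m]$ a non-empty proper subset $S_j$ of $[m]$ is fixed. A directed edge $(u,v)$ is permissible for P1 (in the normal and misère games) and for Stopper (in the escape game) if $\sigma(v)\in S_{\sigma(u)}$; it is permissible for P2 and for Escaper if $\sigma(v)\in[m]\setminus S_{\sigma(u)}$. A token is placed on an initial vertex, and the two players alternately move it along a directed edge permissible for the player whose turn it is. Normal game (P1 vs P2): the first player who is unable to move loses. Misère game (P1 vs P2): the first player who is unable to move wins. In both, if no player is ever unable to move, the game is a draw. Escape game (Stopper vs Escaper): if either player is ever unable to move, Stopper wins; otherwise Escaper wins. Outcomes are those under optimal play. Outcome probabilities. For $i=1,2$ and $j\in[m]$, conditioned on $\sigma(\phi)=j$: $\mathrm{nw}_{i,j}$ (resp. $\mathrm{nl}_{i,j}$) is the probability that the normal game with initial vertex $\phi$ and with P$i$ playing the first round is won (resp. lost) by P$i$; $\mathrm{mw}_{i,j}$ and $\mathrm{ml}_{i,j}$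 are the analogous probabilities for the misère game; $\mathrm{esw}_j$ is the probability that Stopper wins the escape game with initial vertex $\phi$ when Stopper plays the first round; $\mathrm{eel}_j$ is the probability that Escaper loses the escape game with initial vertex $\phi$ when Escaper plays the first round. Vectors: $\mathbf{nw}_i=(\mathrm{nw}_{i,j}:j\in[m])$, and likewise $\mathbf{nl}_i,\mathbf{mw}_i,\mathbf{ml}_i$; $\mathbf{x}\preceq\mathbf{y}$ means coordinatewise $\le$. Generating functions. For $S\subseteq[m]$, $\chi_{j,S}$ is the law of $(X_{v,k}:k\in S)$ given $\sigma(v)=j$, and $G_{j,S}$ is its probability generating function on $[0,1]^S$, $G_{j,S}(x_k:k\in S)=\sum_{(n_k)\in\mathbb{N}_0^{S}}\prod_{k\in S}x_k^{n_k}\,\chi_{j,S}(n_k:k\in S)$; $\partial_k$ denotes the partial derivative with respect to $x_k$. $\alpha_j$ (resp. $\beta_j$) is the probability, conditioned on $\sigma(\phi)=j$, that $\phi$ has no child of colour $k$ for any $k\in S_j$ (resp. any $k\in[m]\setminus S_j$). *)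

theory Defs
  imports "HOL-Probability.Probability"
begin

section \<open>The multi-type Galton--Watson tree\<close>

text \<open>
  The colour set is a finite type \<open>'c\<close>. Vertices carry Ulam--Harris labels: the root is
  \<open>[]\<close>, and \<open>v @ [(k, n)]\<close> is the \<open>n\<close>-th child of colour \<open>k\<close> of \<open>v\<close> (counting from 0).
  A sample consists of the colour of the root and of a vector \<open>X v\<close> of offspring numbers for
  every label; labels that do not belong to the tree are never reached from the root.
  Given the root colour \<open>r\<close>, the colour of every label is determined, so the offspring vectors
  are independent with \<open>X v\<close> distributed as \<open>chi (colour r v)\<close>.
\<close>

type_synonym 'c vertex = "('c \<times> nat) list"
type_synonym 'c sample = "'c \<times> ('c vertex \<Rightarrow> 'c \<Rightarrow> nat)"

definition colour :: "'c \<Rightarrow> 'c vertex \<Rightarrow> 'c" where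
  "colour r v = (if v = [] then r else fst (last v))"

definition children :: "('c vertex \<Rightarrow> 'c \<Rightarrow> nat) \<Rightarrow> 'c vertex \<Rightarrow> 'c vertex set" where
  "children X v = {v @ [(k, n)] | k n. n < X v k}"

definition sample_space :: "'c sample measure" where
  "sample_space = count_space UNIV \<Otimes>\<^sub>M (\<Pi>\<^sub>M v\<in>UNIV. count_space UNIV)"

definition gw_rooted :: "('c::finite \<Rightarrow> ('c \<Rightarrow> nat) pmf) \<Rightarrow> 'c \<Rightarrow> 'c sample measure" where
  "gw_rooted chi r =
     distr (\<Pi>\<^sub>M v\<in>UNIV. measure_pmf (chi (colour r v))) sample_space (Pair r)"

definition gw_tree :: "'c pmf \<Rightarrow> ('c::finite \<Rightarrow> ('c \<Rightarrow> nat) pmf) \<Rightarrow> 'c sample measure" where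
  "gw_tree p chi = measure_pmf p \<bind> gw_rooted chi"

text \<open>
  Probability of an event given that the root has colour \<open>j\<close>. For a colour which the root has
  with probability 0 the quotient is meaningless, and the conditional law is read as the law of
  the tree grown from a root of colour \<open>j\<close>. The lemma \<open>root_prob_eq\<close> below shows that this is
  also what the quotient gives in the other case.
\<close>

definition root_prob ::
    "'c pmf \<Rightarrow> ('c::finite \<Rightarrow> ('c \<Rightarrow> nat) pmf) \<Rightarrow> 'c \<Rightarrow> ('c sample \<Rightarrow> bool) \<Rightarrow> real" where
  "root_prob p chi j E =
     (if pmf p j > 0 then cond_prob (gw_tree p chi) E (\<lambda>\<omega>. fst \<omega> = j)
      else measure (gw_rooted chi j) {\<omega> \<in> space (gw_rooted chi j). E \<omega>})"

lemma Pair_measurable_sample: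
  "Pair r \<in> (\<Pi>\<^sub>M v\<in>UNIV. measure_pmf (chi (colour r v))) \<rightarrow>\<^sub>M sample_space"
proof -
  have "sets (\<Pi>\<^sub>M v\<in>UNIV. measure_pmf (chi (colour r v))) =
        sets (\<Pi>\<^sub>M v\<in>UNIV. count_space UNIV)"
    by (intro sets_PiM_cong) auto
  then show ?thesis
    unfolding sample_space_def
    by (subst measurable_cong_sets[OF _ refl]) (auto intro: measurable_Pair1')
qed

lemma sets_gw_rooted: "sets (gw_rooted chi r) = sets sample_space"
  by (simp add: gw_rooted_def)

lemma space_gw_rooted: "space (gw_rooted chi r) = UNIV"
  by (auto simp: gw_rooted_def sample_space_def space_pair_measure space_PiM)

lemma prob_space_gw_rooted: "prob_space (gw_rooted chi r)"
proof -
  interpret P: product_prob_space "\<lambda>v. measure_pmf (chi (colour r v))" UNIV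
    by unfold_locales
  show ?thesis
    unfolding gw_rooted_def by (rule P.prob_space_distr[OF Pair_measurable_sample])
qed

lemma gw_rooted_measurable:
  "gw_rooted chi \<in> measure_pmf p \<rightarrow>\<^sub>M subprob_algebra sample_space"
  by (auto simp: space_subprob_algebra sets_gw_rooted prob_space_gw_rooted
      intro: prob_space_imp_subprob_space)

lemma sets_gw_tree: "sets (gw_tree p chi) = sets sample_space"
  unfolding gw_tree_def by (rule sets_bind) (auto simp: sets_gw_rooted)

lemma root_colour_measurable: "{\<omega>. fst \<omega> = j} \<in> sets sample_space"
proof -
  have "fst -` {j} \<inter> space sample_space \<in> sets sample_space"
    unfolding sample_space_def by (rule measurable_sets[OF measurable_fst]) simp
  then show ?thesis
    by (simp add: sample_space_def space_pair_measure space_PiM vimage_def)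
qed

lemma measure_gw_tree_root:
  assumes "{\<omega>. E \<omega>} \<in> sets sample_space"
  shows "measure (gw_tree p chi) {\<omega>. E \<omega> \<and> fst \<omega> = j} =
         pmf p j * measure (gw_rooted chi j) {\<omega>. E \<omega>}"
proof -
  have S: "{\<omega>. E \<omega> \<and> fst \<omega> = j} \<in> sets sample_space"
    using sets.Int[OF assms root_colour_measurable[of j]] by (simp add: Collect_conj_eq)
  have D: "Pair r -` {\<omega>. E \<omega> \<and> fst \<omega> = j} = (if r = j then Pair j -` {\<omega>. E \<omega>} else {})" for r
    by auto
  have "emeasure (gw_rooted chi r) {\<omega>. E \<omega> \<and> fst \<omega> = j} =
        emeasure (gw_rooted chi j) {\<omega>. E \<omega>} * indicator {j} r" for r
    unfolding gw_rooted_def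
    by (cases "r = j")
      (simp_all add: emeasure_distr[OF Pair_measurable_sample S]
        emeasure_distr[OF Pair_measurable_sample assms] D)
  then have "emeasure (gw_tree p chi) {\<omega>. E \<omega> \<and> fst \<omega> = j} =
        (\<integral>\<^sup>+ r. emeasure (gw_rooted chi j) {\<omega>. E \<omega>} * indicator {j} r \<partial>measure_pmf p)"
    unfolding gw_tree_def
    by (subst emeasure_bind[OF _ gw_rooted_measurable S]) auto
  also have "\<dots> = emeasure (gw_rooted chi j) {\<omega>. E \<omega>} * ennreal (pmf p j)"
    by (subst nn_integral_cmult_indicator) (auto simp: emeasure_pmf_single)
  finally show ?thesis
    by (simp add: measure_def enn2real_mult mult.commute)
qed

lemma root_prob_eq:
  assumes "{\<omega>. E \<omega>} \<in> sets sample_space"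
  shows "root_prob p chi j E = measure (gw_rooted chi j) {\<omega>. E \<omega>}"
proof -
  have sp: "space (gw_tree p chi) = UNIV"
    using sets_eq_imp_space_eq[OF sets_gw_tree[of p chi]]
    by (simp add: sample_space_def space_pair_measure space_PiM)
  have "measure (gw_tree p chi) {\<omega>. fst \<omega> = j} = pmf p j"
    using measure_gw_tree_root[of "\<lambda>_. True" p chi j]
      prob_space.prob_space[OF prob_space_gw_rooted[of chi j]]
      sets.top[of "sample_space :: 'a sample measure"]
    by (simp add: space_gw_rooted sample_space_def space_pair_measure space_PiM)
  then show ?thesis
    using measure_gw_tree_root[OF assms, of p chi j]
    by (simp add: root_prob_def cond_prob_def sp space_gw_rooted)
qed


section \<open>Alternating token games\<close>

datatype player = P1 | P2

fun opponent :: "player \<Rightarrow> player" where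
  "opponent P1 = P2"
| "opponent P2 = P1"

definition turn :: "player \<Rightarrow> nat \<Rightarrow> player" where
  "turn i n = (if even n then i else opponent i)"

text \<open>
  \<open>mv q v\<close> is the set of vertices to which \<open>q\<close> may move the token from \<open>v\<close>. A strategy selects
  a move at every vertex where there is one; on a tree with a fixed initial vertex and a fixed
  first player, the position of the token determines the history of the game, so that
  strategies depending on the position alone are general. The player \<open>i\<close> plays the first round.
\<close>

definition legal :: "(player \<Rightarrow> 'v \<Rightarrow> 'v set) \<Rightarrow> player \<Rightarrow> ('v \<Rightarrow> 'v) \<Rightarrow> bool" where
  "legal mv q s \<longleftrightarrow> (\<forall>v. mv q v \<noteq> {} \<longrightarrow> s v \<in> mv q v)"

primrec token :: "(player \<Rightarrow> 'v \<Rightarrow> 'v) \<Rightarrow> player \<Rightarrow> 'v \<Rightarrow> nat \<Rightarrow> 'v" where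
  "token s i v 0 = v"
| "token s i v (Suc n) = s (turn i n) (token s i v n)"

definition stuck_first ::
    "(player \<Rightarrow> 'v \<Rightarrow> 'v set) \<Rightarrow> (player \<Rightarrow> 'v \<Rightarrow> 'v) \<Rightarrow> player \<Rightarrow> 'v \<Rightarrow> nat \<Rightarrow> bool" where
  "stuck_first mv s i v n \<longleftrightarrow>
     mv (turn i n) (token s i v n) = {} \<and>
     (\<forall>k<n. mv (turn i k) (token s i v k) \<noteq> {})"

definition can_force ::
    "(player \<Rightarrow> 'v \<Rightarrow> 'v set) \<Rightarrow> player \<Rightarrow> ((player \<Rightarrow> 'v \<Rightarrow> 'v) \<Rightarrow> bool) \<Rightarrow> bool" where
  "can_force mv q W \<longleftrightarrow>
     (\<exists>s. legal mv q s \<and>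
          (\<forall>t. legal mv (opponent q) t \<longrightarrow> W (\<lambda>r. if r = q then s else t)))"

definition normal_win :: "(player \<Rightarrow> 'v \<Rightarrow> 'v set) \<Rightarrow> player \<Rightarrow> 'v \<Rightarrow> player \<Rightarrow> bool" where
  "normal_win mv i v q \<longleftrightarrow>
     can_force mv q (\<lambda>s. \<exists>n. stuck_first mv s i v n \<and> turn i n = opponent q)"

definition misere_win :: "(player \<Rightarrow> 'v \<Rightarrow> 'v set) \<Rightarrow> player \<Rightarrow> 'v \<Rightarrow> player \<Rightarrow> bool" where
  "misere_win mv i v q \<longleftrightarrow>
     can_force mv q (\<lambda>s. \<exists>n. stuck_first mv s i v n \<and> turn i n = q)"

text \<open>In the escape game \<open>P1\<close> is Stopper and \<open>P2\<close> is Escaper.\<close>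

definition stopper_win :: "(player \<Rightarrow> 'v \<Rightarrow> 'v set) \<Rightarrow> player \<Rightarrow> 'v \<Rightarrow> bool" where
  "stopper_win mv i v \<longleftrightarrow> can_force mv P1 (\<lambda>s. \<exists>n. stuck_first mv s i v n)"


section \<open>The games on the random tree\<close>

fun allowed :: "('c \<Rightarrow> 'c set) \<Rightarrow> player \<Rightarrow> 'c \<Rightarrow> 'c set" where
  "allowed S P1 j = S j"
| "allowed S P2 j = UNIV - S j"

definition moves :: "('c \<Rightarrow> 'c set) \<Rightarrow> 'c sample \<Rightarrow> player \<Rightarrow> 'c vertex \<Rightarrow> 'c vertex set" where
  "moves S \<omega> q v =
     {w \<in> children (snd \<omega>) v. colour (fst \<omega>) w \<in> allowed S q (colour (fst \<omega>) v)}"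

context
  fixes p :: "'c::finite pmf" and chi :: "'c \<Rightarrow> ('c \<Rightarrow> nat) pmf" and S :: "'c \<Rightarrow> 'c set"
begin

definition nw :: "player \<Rightarrow> 'c \<Rightarrow> real" where
  "nw i j = root_prob p chi j (\<lambda>\<omega>. normal_win (moves S \<omega>) i [] i)"

definition nl :: "player \<Rightarrow> 'c \<Rightarrow> real" where
  "nl i j = root_prob p chi j (\<lambda>\<omega>. normal_win (moves S \<omega>) i [] (opponent i))"

definition mw :: "player \<Rightarrow> 'c \<Rightarrow> real" where
  "mw i j = root_prob p chi j (\<lambda>\<omega>. misere_win (moves S \<omega>) i [] i)"

definition ml :: "player \<Rightarrow> 'c \<Rightarrow> real" where
  "ml i j = root_prob p chi j (\<lambda>\<omega>. misere_win (moves S \<omega>) i [] (opponent i))"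

definition esw :: "'c \<Rightarrow> real" where
  "esw j = root_prob p chi j (\<lambda>\<omega>. stopper_win (moves S \<omega>) P1 [])"

definition eel :: "'c \<Rightarrow> real" where
  "eel j = root_prob p chi j (\<lambda>\<omega>. stopper_win (moves S \<omega>) P2 [])"

definition alpha :: "'c \<Rightarrow> real" where
  "alpha j = root_prob p chi j (\<lambda>\<omega>. \<forall>k\<in>S j. snd \<omega> [] k = 0)"

definition beta :: "'c \<Rightarrow> real" where
  "beta j = root_prob p chi j (\<lambda>\<omega>. \<forall>k\<in>UNIV - S j. snd \<omega> [] k = 0)"

end


section \<open>Generating functions\<close>

definition chi_marginal :: "('c \<Rightarrow> ('c \<Rightarrow> nat) pmf) \<Rightarrow> 'c \<Rightarrow> 'c set \<Rightarrow> ('c \<Rightarrow> nat) pmf" where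
  "chi_marginal chi j T = map_pmf (\<lambda>n. restrict n T) (chi j)"

text \<open>
  A function on the cube over the coordinates in \<open>T\<close> is regarded as a function on the cube over
  all coordinates that does not depend on the others; continuity, convexity, differentiability
  and the partial derivatives along \<open>T\<close> are the same for both. At the boundary of the cube,
  derivatives are relative to the cube, that is, one-sided.
\<close>

definition gen_fun :: "('c::finite \<Rightarrow> ('c \<Rightarrow> nat) pmf) \<Rightarrow> 'c \<Rightarrow> 'c set \<Rightarrow> real ^ 'c \<Rightarrow> real" where
  "gen_fun chi j T x =
     (\<Sum>\<^sub>\<infinity>n\<in>(T \<rightarrow>\<^sub>E UNIV). (\<Prod>k\<in>T. (x $ k) ^ n k) * pmf (chi_marginal chi j T) n)"

definition unit_cube :: "(real ^ 'c::finite) set" where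
  "unit_cube = {x. \<forall>k. 0 \<le> x $ k \<and> x $ k \<le> 1}"

definition partial :: "'c::finite \<Rightarrow> (real ^ 'c \<Rightarrow> real) \<Rightarrow> real ^ 'c \<Rightarrow> real" where
  "partial k f x =
     vector_derivative (\<lambda>t. f (\<chi> l. if l = k then t else x $ l)) (at (x $ k) within {0..1})"

definition C1_on_cube :: "'c::finite set \<Rightarrow> (real ^ 'c \<Rightarrow> real) \<Rightarrow> bool" where
  "C1_on_cube T f \<longleftrightarrow>
     f differentiable_on unit_cube \<and> (\<forall>k\<in>T. continuous_on unit_cube (partial k f))"

end

theory Submission
  imports Defs
begin

text \<open>
  All the games have one shape: a player \<open>q\<close> tries to make the token stop, and a set \<open>A\<close> says whose
  being unable to move counts as success for \<open>q\<close>. Normal play has \<open>A = {opponent q}\<close>, misere play has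
  \<open>A = {q}\<close>, and Stopper in the escape game has both players in \<open>A\<close>. As every vertex has finitely many
  children, \<open>q\<close> has a winning strategy exactly if \<open>q\<close> wins within some bounded number of rounds, which
  is decided by backward induction (\<open>can_force_iff_forces\<close>). Enlarging \<open>A\<close> makes life easier for
  \<open>q\<close>, so the escape game dominates the normal and the misere game on every single tree. This is
  the first claim.

  The subtrees at the children of the root are independent copies of the tree. Hence the
  probability that all children of colours in \<open>T\<close> have a property is the generating function of the
  offspring law, evaluated at the probabilities of the property (\<open>rooted_prob_all_children\<close>). Write
  \<open>G\<^sub>T\<close> for the generating function of the offspring in the colours \<open>T\<close> permitted to the player to
  move. The probabilities that \<open>q\<close> succeeds, \<open>v\<close> with \<open>q\<close> to move and \<open>w\<close> with the opponent to move,
  satisfy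
  \<open>v = 1 - G\<^sub>T(1 - w) + [q \<in> A] G\<^sub>T(0)\<close> and \<open>w = G\<^sub>T(v) - [opponent q \<notin> A] G\<^sub>T(0)\<close>,
  where \<open>G\<^sub>T(0)\<close> is the probability that there is no move. The same holds for games of bounded length, with
  the bound \<open>n + 1\<close> on the left and \<open>n\<close> on the right.

  For the second claim, let \<open>e\<close> be the least coordinate of \<open>w\<close> in \<open>T\<close>. The point \<open>1 - e\<close> lies above
  \<open>1 - w\<close>, and along an increasing segment a power series with nonnegative coefficients is convex,
  so \<open>G\<^sub>T(1 - e) - G\<^sub>T(1 - w)\<close> is at least the directional derivative at \<open>1 - w\<close>
  (\<open>gen_fun_tangent\<close>). In the expectation \<open>G\<^sub>T(1 - e)\<close>, in turn, every monomial
  other than \<open>1\<close> is at most \<open>1 - e\<close>. Together with the equation for \<open>v\<close> this is the bound.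

  For the third claim, compare the bounded normal games with the complete misere game by induction
  over pairs of rounds. Passing from normal to misere play helps a player who is stuck. At the root this
  benefits the first player; after one round it benefits the opponent. Which effect prevails is
  decided by the increment of \<open>G\<^sub>T\<close> that the second effect causes, and the increments of monomials satisfy
  \<open>\<Prod>y\<^sup>n - \<Prod>x\<^sup>n \<ge> y\<^sub>i - x\<^sub>i\<close> if \<open>x \<le> y\<close> and \<open>n\<close> is the \<open>i\<close>-th unit vector, and
  \<open>\<Prod>y\<^sup>n - \<Prod>x\<^sup>n \<le> \<Sum>n\<^sub>i b\<^sub>i\<close> if \<open>y \<le> x + b\<close>. In expectation these become
  \<open>pgf_increment_lower\<close> and \<open>pgf_increment_upper\<close>, and the two hypotheses ensure that the second
  effect outweighs the first, or that it does not (\<open>nl_le_ml\<close>, \<open>nw_le_mw\<close>).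
\<close>

section \<open>Backward induction for token games\<close>

text \<open>
  Here \<open>q\<close> is the player who wants to succeed, \<open>r\<close> is the player to move at \<open>v\<close>, and \<open>n\<close> bounds the
  number of positions visited, the one where the play stops included.
\<close>

primrec forces_in ::
    "(player \<Rightarrow> 'v \<Rightarrow> 'v set) \<Rightarrow> player \<Rightarrow> (player \<Rightarrow> bool) \<Rightarrow> nat \<Rightarrow> player \<Rightarrow> 'v \<Rightarrow> bool" where
  "forces_in mv q A 0 r v \<longleftrightarrow> False"
| "forces_in mv q A (Suc n) r v \<longleftrightarrow>
     (if mv r v = {} then A r
      else if r = q then \<exists>w\<in>mv r v. forces_in mv q A n (opponent r) w
      else \<forall>w\<in>mv r v. forces_in mv q A n (opponent r) w)"

definition forces ::
    "(player \<Rightarrow> 'v \<Rightarrow> 'v set) \<Rightarrow> player \<Rightarrow> (player \<Rightarrow> bool) \<Rightarrow> player \<Rightarrow> 'v \<Rightarrow> bool" where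
  "forces mv q A r v \<longleftrightarrow> (\<exists>n. forces_in mv q A n r v)"

lemma opponent_neq [simp]: "opponent q \<noteq> q" "q \<noteq> opponent q"
  by (cases q; simp)+

lemma opponent_opponent [simp]: "opponent (opponent q) = q"
  by (cases q) auto

lemma neq_iff_opponent: "r \<noteq> q \<longleftrightarrow> r = opponent q"
  by (cases q; cases r) auto

lemma turn_0 [simp]: "turn i 0 = i"
  by (simp add: turn_def)

lemma turn_Suc [simp]: "turn i (Suc n) = opponent (turn i n)"
  by (simp add: turn_def)

lemma forces_in_mono: "forces_in mv q A m r v \<Longrightarrow> m \<le> n \<Longrightarrow> forces_in mv q A n r v"
proof (induction m arbitrary: n r v)
  case (Suc m)
  then obtain n' where n: "n = Suc n'" "m \<le> n'"
    by (cases n) auto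
  then have "forces_in mv q A m r v \<Longrightarrow> forces_in mv q A n' r v" for r v
    using Suc.IH by blast
  then show ?case
    using Suc.prems(1) by (auto simp: n(1) split: if_splits)
qed simp

text \<open>
  This is where finite branching enters: when the opponent moves, each of the finitely many answers
  comes with its own bound on the number of rounds, and the largest of these bounds works for all.
\<close>

lemma forces_fixpoint:
  assumes "finite (mv r v)"
  shows "forces mv q A r v \<longleftrightarrow>
     (if mv r v = {} then A r
      else if r = q then \<exists>w\<in>mv r v. forces mv q A (opponent r) w
      else \<forall>w\<in>mv r v. forces mv q A (opponent r) w)" (is "?L \<longleftrightarrow> ?R")
proof
  assume ?L
  then obtain n where "forces_in mv q A n r v"
    by (auto simp: forces_def)
  then obtain m where "forces_in mv q A (Suc m) r v"
    by (cases n) auto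
  then show ?R
    by (auto simp: forces_def split: if_splits)
next
  assume R: ?R
  consider "mv r v = {}" | "mv r v \<noteq> {}" "r = q" | "mv r v \<noteq> {}" "r \<noteq> q"
    by blast
  then show ?L
  proof cases
    case 1
    then have "forces_in mv q A (Suc 0) r v"
      using R by simp
    then show ?thesis
      unfolding forces_def by blast
  next
    case 2
    then obtain w n where "w \<in> mv r v" "forces_in mv q A n (opponent r) w"
      using R by (auto simp: forces_def)
    then have "forces_in mv q A (Suc n) r v"
      using 2 by auto
    then show ?thesis
      unfolding forces_def by blast
  next
    case 3
    then have "\<forall>w\<in>mv r v. \<exists>n. forces_in mv q A n (opponent r) w"
      using R by (auto simp: forces_def)
    then obtain N where N: "\<And>w. w \<in> mv r v \<Longrightarrow> forces_in mv q A (N w) (opponent r) w"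
      by metis
    have "forces_in mv q A (Max (N ` mv r v)) (opponent r) w" if "w \<in> mv r v" for w
      using forces_in_mono[OF N[OF that]] that assms by simp
    then have "forces_in mv q A (Suc (Max (N ` mv r v))) r v"
      using 3 by simp
    then show ?thesis
      unfolding forces_def by blast
  qed
qed

text \<open>
  A strategy depends on the position only, so it cannot be told how many rounds are left. Moving
  so as to succeed within the least number of rounds for the present position is good for every budget.
\<close>

lemma forcing_strategy:
  obtains s where "legal mv q s"
    "\<And>n v. forces_in mv q A (Suc n) q v \<Longrightarrow> mv q v \<noteq> {} \<Longrightarrow> forces_in mv q A n (opponent q) (s v)"
proof -
  define rank where "rank v = (LEAST n. forces_in mv q A n q v)" for v
  define good where "good v w \<longleftrightarrow>
      w \<in> mv q v \<and> (forces mv q A q v \<longrightarrow> forces_in mv q A (rank v - 1) (opponent q) w)" for v w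
  define s where "s v = (SOME w. good v w)" for v
  have good_s: "good v (s v)" if ne: "mv q v \<noteq> {}" for v
  proof -
    have "\<exists>w. good v w"
    proof (cases "forces mv q A q v")
      case True
      then have r: "forces_in mv q A (rank v) q v"
        unfolding rank_def forces_def by (rule LeastI_ex)
      then obtain m where "rank v = Suc m"
        by (cases "rank v") auto
      then show ?thesis
        using r ne by (auto simp: good_def)
    next
      case False
      then show ?thesis
        using ne by (auto simp: good_def)
    qed
    then show ?thesis
      unfolding s_def by (rule someI_ex)
  qed
  show ?thesis
  proof
    show "legal mv q s"
      using good_s by (auto simp: legal_def good_def)
  next
    fix n v assume F: "forces_in mv q A (Suc n) q v" and ne: "mv q v \<noteq> {}"
    have "rank v \<le> Suc n"
      unfolding rank_def using F by (rule Least_le)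
    moreover have "forces mv q A q v"
      using F unfolding forces_def by blast
    ultimately show "forces_in mv q A n (opponent q) (s v)"
      using good_s[OF ne] forces_in_mono[of mv q A "rank v - 1" "opponent q" "s v" n]
      by (auto simp: good_def)
  qed
qed

text \<open>
  If \<open>q\<close> can succeed in boundedly many rounds, the rank-minimising strategy decreases the bound in
  each round, whatever the opponent does. Otherwise the opponent can stay in positions from which
  \<open>q\<close> does not succeed; a play that stops there stops in the opponent's favour.
\<close>

lemma can_force_iff_forces:
  assumes fin: "\<And>r v. finite (mv r v)"
  shows "can_force mv q (\<lambda>s. \<exists>n. stuck_first mv s i v n \<and> A (turn i n)) \<longleftrightarrow> forces mv q A i v"
    (is "?L \<longleftrightarrow> ?R")
proof
  assume ?R
  then obtain N where N: "forces_in mv q A N i v"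
    by (auto simp: forces_def)
  obtain s where s: "legal mv q s"
    and s_step: "\<And>n v. forces_in mv q A (Suc n) q v \<Longrightarrow> mv q v \<noteq> {} \<Longrightarrow>
        forces_in mv q A n (opponent q) (s v)"
    using forcing_strategy by blast
  have "\<exists>n. stuck_first mv \<sigma> i v n \<and> A (turn i n)"
    if t: "legal mv (opponent q) t" and \<sigma>: "\<sigma> = (\<lambda>r. if r = q then s else t)" for t \<sigma>
  proof -
    have "\<exists>n. stuck_first mv \<sigma> i v n \<and> A (turn i n)"
      if "forces_in mv q A N (turn i m) (token \<sigma> i v m)"
        and "\<forall>k<m. mv (turn i k) (token \<sigma> i v k) \<noteq> {}" for N m
      using that
    proof (induction N arbitrary: m)
      case (Suc N)
      let ?r = "turn i m" and ?w = "token \<sigma> i v m"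
      show ?case
      proof (cases "mv ?r ?w = {}")
        case True
        then show ?thesis
          using Suc.prems by (auto simp: stuck_first_def)
      next
        case False
        have "forces_in mv q A N (opponent ?r) (\<sigma> ?r ?w)"
        proof (cases "?r = q")
          case True
          then show ?thesis
            using s_step Suc.prems(1) False by (simp add: \<sigma>)
        next
          case neq: False
          then have "\<sigma> ?r ?w \<in> mv ?r ?w"
            using t False by (auto simp: \<sigma> legal_def neq_iff_opponent)
          then show ?thesis
            using Suc.prems(1) False neq by simp
        qed
        then show ?thesis
          using Suc.IH[of "Suc m"] Suc.prems(2) False by (auto simp: less_Suc_eq)
      qed
    qed simp
    from this[of N 0] show ?thesis
      using N by simp
  qed
  then show ?L
    unfolding can_force_def using s by blast
next
  assume ?L
  then obtain s where s: "legal mv q s"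
    and win: "\<And>t. legal mv (opponent q) t \<Longrightarrow>
       \<exists>n. stuck_first mv (\<lambda>r. if r = q then s else t) i v n \<and> A (turn i n)"
    unfolding can_force_def by blast
  define good where "good v w \<longleftrightarrow> w \<in> mv (opponent q) v \<and>
      (\<not> forces mv q A (opponent q) v \<longrightarrow> \<not> forces mv q A q w)" for v w
  define t where "t v = (SOME w. good v w)" for v
  have good_t: "good v (t v)" if "mv (opponent q) v \<noteq> {}" for v
  proof -
    have "\<exists>w. good v w"
      using that forces_fixpoint[of mv "opponent q" v q A] fin by (auto simp: good_def)
    then show ?thesis
      unfolding t_def by (rule someI_ex)
  qed
  then have t: "legal mv (opponent q) t"
    by (auto simp: legal_def good_def)
  define \<sigma> where "\<sigma> = (\<lambda>r. if r = q then s else t)"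
  show ?R
  proof (rule ccontr)
    assume nR: "\<not> ?R"
    \<comment> \<open>The strategy \<open>t\<close> keeps the token in positions that are not forced.\<close>
    have avoid: "\<not> forces mv q A (turn i m) (token \<sigma> i v m)"
      if "\<forall>k<m. mv (turn i k) (token \<sigma> i v k) \<noteq> {}" for m
      using that
    proof (induction m)
      case (Suc m)
      let ?r = "turn i m" and ?w = "token \<sigma> i v m"
      have ne: "mv ?r ?w \<noteq> {}" and nF: "\<not> forces mv q A ?r ?w"
        using Suc by (auto simp: less_Suc_eq)
      show ?case
      proof (cases "?r = q")
        case True
        then have "s ?w \<in> mv q ?w"
          using s ne by (auto simp: legal_def)
        then show ?thesis
          using nF ne True forces_fixpoint[of mv q ?w q A] fin by (auto simp: \<sigma>_def)
      next
        case False
        then show ?thesis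
          using good_t[of ?w] nF ne by (auto simp: good_def neq_iff_opponent \<sigma>_def)
      qed
    qed (use nR in simp)
    obtain n where n: "stuck_first mv \<sigma> i v n" "A (turn i n)"
      using win[OF t] by (auto simp: \<sigma>_def)
    then show False
      using avoid[of n] forces_fixpoint[of mv "turn i n" "token \<sigma> i v n" q A] fin
      by (auto simp: stuck_first_def)
  qed
qed

section \<open>Subtrees and measurability\<close>

lemma space_sample_space [simp]: "space sample_space = UNIV"
  by (auto simp: sample_space_def space_pair_measure space_PiM)

lemma measurable_root [measurable]: "fst \<in> sample_space \<rightarrow>\<^sub>M count_space UNIV"
  unfolding sample_space_def by simp

lemma measurable_offspring [measurable]: "(\<lambda>\<omega>. snd \<omega> v) \<in> sample_space \<rightarrow>\<^sub>M count_space UNIV"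
  unfolding sample_space_def by simp

definition subtree :: "'c \<times> nat \<Rightarrow> 'c sample \<Rightarrow> 'c sample" where
  "subtree a \<omega> = (fst a, \<lambda>u. snd \<omega> (a # u))"

lemma measurable_subtree [measurable]: "subtree a \<in> sample_space \<rightarrow>\<^sub>M sample_space"
proof -
  have "(\<lambda>\<omega> u. snd \<omega> (a # u)) \<in> sample_space \<rightarrow>\<^sub>M (\<Pi>\<^sub>M v\<in>UNIV. count_space UNIV)"
    by (rule measurable_PiM_single') auto
  then have "(\<lambda>\<omega>. (fst a, \<lambda>u. snd \<omega> (a # u))) \<in>
      sample_space \<rightarrow>\<^sub>M count_space UNIV \<Otimes>\<^sub>M (\<Pi>\<^sub>M v\<in>UNIV. count_space UNIV)"
    by (intro measurable_Pair) auto
  then show ?thesis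
    by (simp add: sample_space_def subtree_def[abs_def])
qed

lemma measurable_offspring_count [measurable]:
  "(\<lambda>\<omega>. snd \<omega> v k) \<in> sample_space \<rightarrow>\<^sub>M count_space UNIV"
  by (rule measurable_compose[OF measurable_offspring]) simp

lemma pred_subtree:
  "Measurable.pred sample_space Q \<Longrightarrow> Measurable.pred sample_space (\<lambda>\<omega>. Q (subtree a \<omega>))"
  by (rule measurable_compose[OF measurable_subtree])

lemma pred_no_children [measurable]:
  fixes T :: "'c::finite set"
  shows "Measurable.pred sample_space (\<lambda>\<omega>. \<forall>k\<in>T. snd \<omega> [] k = 0)"
  by measurable

lemma pred_all_children:
  fixes T :: "'c::finite set"
  assumes Q: "Measurable.pred sample_space Q"
  shows "Measurable.pred sample_space (\<lambda>\<omega>. \<forall>k\<in>T. \<forall>m<snd \<omega> [] k. Q (subtree (k, m) \<omega>))"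
proof -
  note [measurable] = pred_subtree[OF Q]
  show ?thesis
    by measurable
qed

text \<open>
  Below a child of the root, the labels record the colours without reference to the root. So the
  game below a child is the game on the child's own subtree.
\<close>

lemma moves_Cons: "moves S \<omega> q (a # u) = (#) a ` moves S (subtree a \<omega>) q u"
proof -
  have "colour (fst \<omega>) (a # u) = colour (fst a) u" "colour (fst \<omega>) (a # u @ [b]) = colour (fst a) (u @ [b])"
    for u b by (simp_all add: colour_def)
  then show ?thesis
    by (auto simp: moves_def children_def subtree_def)
qed

lemma forces_in_Cons:
  "forces_in (moves S \<omega>) q A n r (a # u) \<longleftrightarrow> forces_in (moves S (subtree a \<omega>)) q A n r u"
  by (induction n arbitrary: r u) (simp_all add: moves_Cons)

lemma moves_root:
  "moves S \<omega> q [] = {[(k, m)] | k m. k \<in> allowed S q (fst \<omega>) \<and> m < snd \<omega> [] k}"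
  by (auto simp: moves_def children_def colour_def)

lemma moves_root_empty:
  "moves S \<omega> q [] = {} \<longleftrightarrow> (\<forall>k\<in>allowed S q (fst \<omega>). snd \<omega> [] k = 0)"
  by (auto simp: moves_root)

lemma finite_moves: "finite (moves S (\<omega> :: 'c::finite sample) q v)"
proof -
  have "children (snd \<omega>) v = (\<Union>k. (\<lambda>n. v @ [(k, n)]) ` {..<snd \<omega> v k})"
    by (auto simp: children_def)
  then have "finite (children (snd \<omega>) v)"
    by simp
  then show ?thesis
    by (simp add: moves_def)
qed

lemma bex_moves_root:
  "(\<exists>w\<in>moves S \<omega> q []. P w) \<longleftrightarrow> (\<exists>k\<in>allowed S q (fst \<omega>). \<exists>m<snd \<omega> [] k. P [(k, m)])"
  by (force simp: moves_root)

lemma ball_moves_root: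
  "(\<forall>w\<in>moves S \<omega> q []. P w) \<longleftrightarrow> (\<forall>k\<in>allowed S q (fst \<omega>). \<forall>m<snd \<omega> [] k. P [(k, m)])"
  by (force simp: moves_root)

lemma forces_in_root:
  "forces_in (moves S \<omega>) q A (Suc n) r [] \<longleftrightarrow>
    (if \<forall>k\<in>allowed S r (fst \<omega>). snd \<omega> [] k = 0 then A r
     else if r = q then
       \<exists>k\<in>allowed S r (fst \<omega>). \<exists>m<snd \<omega> [] k.
         forces_in (moves S (subtree (k, m) \<omega>)) q A n (opponent r) []
     else
       \<forall>k\<in>allowed S r (fst \<omega>). \<forall>m<snd \<omega> [] k.
         forces_in (moves S (subtree (k, m) \<omega>)) q A n (opponent r) [])"
  by (simp add: moves_root_empty bex_moves_root ball_moves_root forces_in_Cons)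

lemma forces_root:
  fixes \<omega> :: "'c::finite sample"
  shows "forces (moves S \<omega>) q A r [] \<longleftrightarrow>
    (if \<forall>k\<in>allowed S r (fst \<omega>). snd \<omega> [] k = 0 then A r
     else if r = q then
       \<exists>k\<in>allowed S r (fst \<omega>). \<exists>m<snd \<omega> [] k.
         forces (moves S (subtree (k, m) \<omega>)) q A (opponent r) []
     else
       \<forall>k\<in>allowed S r (fst \<omega>). \<forall>m<snd \<omega> [] k.
         forces (moves S (subtree (k, m) \<omega>)) q A (opponent r) [])"
  by (subst forces_fixpoint[OF finite_moves])
    (simp add: moves_root_empty bex_moves_root ball_moves_root forces_def forces_in_Cons)

lemma pred_forces_in [measurable]:
  fixes S :: "'c::finite \<Rightarrow> 'c set"
  shows "Measurable.pred sample_space (\<lambda>\<omega>. forces_in (moves S \<omega>) q A n r [])"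
proof (induction n arbitrary: r)
  case (Suc n)
  note [measurable] = pred_subtree[OF Suc]
  have [measurable]: "Measurable.pred sample_space (\<lambda>\<omega>. k \<in> allowed S r (fst \<omega>))" for k
    by (rule measurable_compose[OF measurable_root]) simp
  show ?case
    unfolding forces_in_root Ball_def Bex_def by measurable
qed simp

lemma pred_forces [measurable]:
  fixes S :: "'c::finite \<Rightarrow> 'c set"
  shows "Measurable.pred sample_space (\<lambda>\<omega>. forces (moves S \<omega>) q A r [])"
  unfolding forces_def by measurable

section \<open>Independence of the subtrees at the children of the root\<close>

abbreviation offspring_laws ::
    "('c \<Rightarrow> ('c \<Rightarrow> nat) pmf) \<Rightarrow> 'c \<Rightarrow> ('c::finite vertex \<Rightarrow> 'c \<Rightarrow> nat) measure" where
  "offspring_laws chi j \<equiv> (\<Pi>\<^sub>M v\<in>UNIV. measure_pmf (chi (colour j v)))"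

definition rooted_prob :: "('c::finite \<Rightarrow> ('c \<Rightarrow> nat) pmf) \<Rightarrow> 'c \<Rightarrow> ('c sample \<Rightarrow> bool) \<Rightarrow> real" where
  "rooted_prob chi j E = measure (gw_rooted chi j) {\<omega>. E \<omega>}"

lemma rooted_prob_eq:
  assumes "Measurable.pred sample_space E"
  shows "rooted_prob chi j E = measure (offspring_laws chi j) {X. E (j, X)}"
  unfolding rooted_prob_def gw_rooted_def
  by (subst measure_distr[OF Pair_measurable_sample]) (use assms in \<open>auto simp: space_PiM pred_def vimage_def\<close>)

lemma root_prob_eq_rooted_prob:
  assumes "Measurable.pred sample_space E"
  shows "root_prob p chi j E = rooted_prob chi j E"
  using root_prob_eq[of E p chi j] assms by (simp add: rooted_prob_def pred_def)

lemma sets_offspring_laws: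
  "sets (offspring_laws chi j) = sets (\<Pi>\<^sub>M v\<in>UNIV. count_space UNIV)"
  by (intro sets_PiM_cong) auto

lemma offspring_laws_subtree:
  "distr (offspring_laws chi j) (offspring_laws chi (fst a)) (\<lambda>X u. X (a # u)) =
    offspring_laws chi (fst a)"
proof -
  have c: "colour j (a # u) = colour (fst a) u" for u
    by (simp add: colour_def)
  show ?thesis
    using distr_PiM_reindex[of UNIV "\<lambda>v. measure_pmf (chi (colour j v))" "(#) a" UNIV]
    by (simp add: measure_pmf.prob_space_axioms c inj_on_def restrict_def)
qed

lemma indep_vars_offspring:
  "prob_space.indep_vars (offspring_laws chi j) (\<lambda>v. measure_pmf (chi (colour j v))) (\<lambda>v X. X v) UNIV"
proof -
  let ?M = "\<lambda>v. measure_pmf (chi (colour j v))"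
  interpret P: product_prob_space ?M UNIV
    by unfold_locales
  have "distr (PiM UNIV ?M) (PiM UNIV ?M) (\<lambda>x. \<lambda>i\<in>UNIV. x i) = PiM UNIV ?M"
    by (simp add: restrict_UNIV)
  moreover have "distr (PiM UNIV ?M) (?M v) (\<lambda>X. X v) = ?M v" for v
    by (rule P.PiM_component) simp
  moreover have "(\<lambda>X. X v) \<in> PiM UNIV ?M \<rightarrow>\<^sub>M ?M v" for v
    by (rule measurable_component_singleton) simp
  ultimately show ?thesis
    by (subst P.indep_vars_iff_distr_eq_PiM') simp_all
qed

text \<open>
  The offspring vectors of the root and of the vertices below each of its children are indexed by
  disjoint sets of labels, so they are independent; shifting the labels turns the vectors below a
  child into a sample of the tree grown from that child's colour.
\<close>

lemma indep_root_subtrees: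
  fixes chi :: "'c::finite \<Rightarrow> ('c \<Rightarrow> nat) pmf"
  assumes Q [measurable]: "Measurable.pred sample_space Q" and B: "finite B"
  shows "measure (offspring_laws chi j) {X. X [] = x \<and> (\<forall>a\<in>B. Q (subtree a (j, X)))} =
     pmf (chi j) x * (\<Prod>a\<in>B. rooted_prob chi (fst a) Q)"
proof -
  let ?M = "\<lambda>v. measure_pmf (chi (colour j v))"
  interpret P: product_prob_space ?M UNIV
    by unfold_locales
  \<comment> \<open>The index \<open>None\<close> stands for the root, and \<open>Some a\<close> for the labels beginning with \<open>a\<close>.\<close>
  define L where "L = insert None (Some ` B)"
  define K :: "('c \<times> nat) option \<Rightarrow> 'c vertex set" where
    "K l = (case l of None \<Rightarrow> {[]} | Some a \<Rightarrow> range ((#) a))" for l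
  define Y where
    "Y l f \<longleftrightarrow> (case l of None \<Rightarrow> f [] = x | Some a \<Rightarrow> Q (fst a, \<lambda>u. f (a # u)))"
    for l :: "('c \<times> nat) option" and f :: "'c vertex \<Rightarrow> 'c \<Rightarrow> nat"
  have pairQ: "{X. Q (k, X)} \<in> sets (\<Pi>\<^sub>M v\<in>UNIV. count_space UNIV)" for k
  proof -
    have "Pair k \<in> (\<Pi>\<^sub>M v\<in>UNIV. count_space UNIV) \<rightarrow>\<^sub>M sample_space"
      unfolding sample_space_def by simp
    then have "Measurable.pred (\<Pi>\<^sub>M v\<in>UNIV. count_space UNIV) (\<lambda>X. Q (k, X))"
      using measurable_compose[OF _ Q] by blast
    then show ?thesis
      by (simp add: pred_def space_PiM)
  qed
  have Ymeas: "Y l \<in> PiM (K l) ?M \<rightarrow>\<^sub>M count_space UNIV" if "l \<in> L" for l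
  proof (cases l)
    case None
    have "(\<lambda>f. f []) \<in> PiM (K l) ?M \<rightarrow>\<^sub>M ?M []"
      by (rule measurable_component_singleton) (simp add: K_def None)
    then show ?thesis
      unfolding Y_def None by (auto intro: measurable_compose)
  next
    case (Some a)
    have "(\<lambda>f u. f (a # u)) \<in> PiM (K l) ?M \<rightarrow>\<^sub>M (\<Pi>\<^sub>M v\<in>UNIV. count_space UNIV)"
    proof (rule measurable_PiM_single')
      fix u
      have "(\<lambda>f. f (a # u)) \<in> PiM (K l) ?M \<rightarrow>\<^sub>M ?M (a # u)"
        by (rule measurable_component_singleton) (simp add: K_def Some)
      then show "(\<lambda>f. f (a # u)) \<in> PiM (K l) ?M \<rightarrow>\<^sub>M count_space UNIV"
        by (rule measurable_compose) simp
    qed auto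
    moreover have "(\<lambda>X. Q (fst a, X)) \<in> (\<Pi>\<^sub>M v\<in>UNIV. count_space UNIV) \<rightarrow>\<^sub>M count_space UNIV"
      using pairQ[of "fst a"] by (simp add: pred_def space_PiM)
    ultimately show ?thesis
      unfolding Y_def Some using measurable_compose by fastforce
  qed
  have "P.indep_vars (\<lambda>l. PiM (K l) ?M) (\<lambda>l X. restrict (\<lambda>v. X v) (K l)) L"
    by (rule P.indep_vars_restrict[OF indep_vars_offspring])
      (auto simp: K_def disjoint_family_on_def split: option.splits)
  then have ind: "P.indep_vars (\<lambda>_. count_space UNIV) (\<lambda>l X. Y l (restrict X (K l))) L"
    by (rule P.indep_vars_compose2) (fact Ymeas)
  have Yr: "Y l (restrict X (K l)) = Y l X" for l X
    by (auto simp: Y_def K_def split: option.splits)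
  have sp: "space (offspring_laws chi j) = UNIV"
    by (simp add: space_PiM)
  have fL: "finite L"
    using B by (simp add: L_def)
  have sub: "measure (offspring_laws chi j) {X. Q (fst a, \<lambda>u. X (a # u))} =
      rooted_prob chi (fst a) Q" for a
  proof -
    have "(\<lambda>X u. X (a # u)) \<in> offspring_laws chi j \<rightarrow>\<^sub>M offspring_laws chi (fst a)"
      by (rule measurable_PiM_single')
        (auto simp: space_PiM intro!: measurable_compose[OF measurable_component_singleton])
    then have "measure (distr (offspring_laws chi j) (offspring_laws chi (fst a)) (\<lambda>X u. X (a # u)))
        {X. Q (fst a, X)} = measure (offspring_laws chi j) {X. Q (fst a, \<lambda>u. X (a # u))}"
      using pairQ[of "fst a"]
      by (subst measure_distr) (auto simp: sp vimage_def sets_offspring_laws)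
    then show ?thesis
      by (simp add: offspring_laws_subtree rooted_prob_eq[OF Q])
  qed
  have "measure (offspring_laws chi j) (\<Inter>l\<in>L. {X. Y l X}) =
      (\<Prod>l\<in>L. measure (offspring_laws chi j) {X. Y l X})"
    using P.indep_varsD[OF ind, of L "\<lambda>_. {True}"] fL
    by (simp add: Yr sp vimage_def L_def)
  also have "\<dots> = measure (offspring_laws chi j) {X. X [] = x} *
      (\<Prod>a\<in>B. measure (offspring_laws chi j) {X. Q (fst a, \<lambda>u. X (a # u))})"
    using B by (simp add: L_def Y_def prod.reindex)
  also have "(\<Inter>l\<in>L. {X. Y l X}) = {X. X [] = x \<and> (\<forall>a\<in>B. Q (subtree a (j, X)))}"
    by (auto simp: L_def Y_def subtree_def)
  also have "measure (offspring_laws chi j) {X. X [] = x} = pmf (chi j) x"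
  proof -
    have "measure (distr (offspring_laws chi j) (?M []) (\<lambda>X. X [])) {x} =
        measure (offspring_laws chi j) {X. X [] = x}"
      by (subst measure_distr) (auto simp: sp vimage_def)
    moreover have "distr (offspring_laws chi j) (?M []) (\<lambda>X. X []) = measure_pmf (chi j)"
      by (subst P.PiM_component) (simp_all add: colour_def)
    ultimately show ?thesis
      by (simp add: measure_pmf_single)
  qed
  finally show ?thesis
    by (simp add: sub)
qed

definition pgf :: "('c::finite \<Rightarrow> nat) pmf \<Rightarrow> 'c set \<Rightarrow> ('c \<Rightarrow> real) \<Rightarrow> real" where
  "pgf X T g = measure_pmf.expectation X (\<lambda>n. \<Prod>k\<in>T. g k ^ n k)"

lemma monomial_bounds:
  fixes g :: "'c \<Rightarrow> real"
  assumes "\<And>k. k \<in> T \<Longrightarrow> 0 \<le> g k \<and> g k \<le> 1"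
  shows "0 \<le> (\<Prod>k\<in>T. g k ^ n k)" "(\<Prod>k\<in>T. g k ^ n k) \<le> 1"
  using assms by (auto intro!: prod_nonneg prod_le_1 power_le_one)

text \<open>
  The branching identity. Conditionally on the offspring vector \<open>x\<close> of the root, the children have the
  property independently, which contributes the monomial with exponents \<open>x\<close>.
\<close>

lemma rooted_prob_all_children:
  fixes chi :: "'c::finite \<Rightarrow> ('c \<Rightarrow> nat) pmf"
  assumes Q [measurable]: "Measurable.pred sample_space Q"
  shows "rooted_prob chi j (\<lambda>\<omega>. \<forall>k\<in>T. \<forall>m<snd \<omega> [] k. Q (subtree (k, m) \<omega>)) =
     pgf (chi j) T (\<lambda>k. rooted_prob chi k Q)"
proof -
  let ?M = "offspring_laws chi j"
  let ?g = "\<lambda>k. rooted_prob chi k Q"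
  define B where "B x = (SIGMA k:T. {..<x k})" for x :: "'c \<Rightarrow> nat"
  define E where "E x = {X. X [] = x \<and> (\<forall>a\<in>B x. Q (subtree a (j, X)))}" for x
  interpret P: product_prob_space "\<lambda>v. measure_pmf (chi (colour j v))" UNIV
    by unfold_locales
  note [measurable] = pred_subtree[OF Q]
  have [measurable]: "Measurable.pred sample_space (\<lambda>\<omega>. snd \<omega> [] = x)" for x :: "'c \<Rightarrow> nat"
    by (rule measurable_compose[OF measurable_offspring]) simp
  have fB: "finite (B x)" for x
    by (simp add: B_def)
  have sE: "E x \<in> sets ?M" for x
  proof -
    have "Measurable.pred sample_space (\<lambda>\<omega>. snd \<omega> [] = x \<and> (\<forall>a\<in>B x. Q (subtree a \<omega>)))"
      using fB by measurable
    then have "Measurable.pred ?M (\<lambda>X. snd (j, X) [] = x \<and> (\<forall>a\<in>B x. Q (subtree a (j, X))))"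
      by (rule measurable_compose[OF Pair_measurable_sample])
    then show ?thesis
      by (simp add: E_def pred_def space_PiM)
  qed
  have mE: "emeasure ?M (E x) = ennreal (pmf (chi j) x) * ennreal (\<Prod>k\<in>T. ?g k ^ x k)" for x
  proof -
    have "(\<Prod>a\<in>B x. ?g (fst a)) = (\<Prod>k\<in>T. ?g k ^ x k)"
      using prod.Sigma[of T "\<lambda>k. {..<x k}" "\<lambda>k _. ?g k"] by (simp add: B_def split_def)
    then show ?thesis
      using indep_root_subtrees[OF Q fB, of chi j x x]
      by (simp add: P.emeasure_eq_measure E_def ennreal_mult' )
  qed
  have g: "0 \<le> ?g k \<and> ?g k \<le> 1" for k
    using prob_space.prob_le_1[OF prob_space_gw_rooted] by (auto simp: rooted_prob_def)
  have "ennreal (rooted_prob chi j (\<lambda>\<omega>. \<forall>k\<in>T. \<forall>m<snd \<omega> [] k. Q (subtree (k, m) \<omega>))) =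
      emeasure ?M {X. \<forall>k\<in>T. \<forall>m<X [] k. Q (subtree (k, m) (j, X))}"
    by (simp add: rooted_prob_eq[OF pred_all_children[OF Q]] P.emeasure_eq_measure)
  also have "{X. \<forall>k\<in>T. \<forall>m<X [] k. Q (subtree (k, m) (j, X))} = (\<Union>x. E x)"
    by (auto simp: E_def B_def)
  also have "emeasure ?M (\<Union>x. E x) = (\<integral>\<^sup>+x. emeasure ?M (E x) \<partial>count_space UNIV)"
    using sE by (intro emeasure_UN_countable) (auto simp: disjoint_family_on_def E_def)
  also have "\<dots> = (\<integral>\<^sup>+x. ennreal (\<Prod>k\<in>T. ?g k ^ x k) \<partial>measure_pmf (chi j))"
    by (simp add: nn_integral_measure_pmf mE)
  also have "\<dots> = ennreal (pgf (chi j) T ?g)"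
    unfolding pgf_def
    by (rule nn_integral_eq_integral)
      (auto intro!: measure_pmf.integrable_const_bound[where B = 1] AE_I2 monomial_bounds
        simp: g abs_of_nonneg[OF monomial_bounds(1)])
  finally show ?thesis
    by (subst (asm) ennreal_inj)
      (auto simp: rooted_prob_def pgf_def g[unfolded rooted_prob_def]
        intro!: integral_nonneg_AE AE_I2 monomial_bounds)
qed

section \<open>Increments of probability generating functions\<close>

text \<open>
  Expectations of monomials are easier to handle than sums over the support of the marginal law;
  on the cube the two agree.
\<close>

lemma gen_fun_eq_pgf:
  fixes chi :: "'c::finite \<Rightarrow> ('c \<Rightarrow> nat) pmf"
  assumes x: "x \<in> unit_cube"
  shows "gen_fun chi j T x = pgf (chi j) T (($) x)"
proof -
  let ?f = "\<lambda>n. \<Prod>k\<in>T. (x $ k) ^ n k" and ?q = "chi_marginal chi j T"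
  have f: "0 \<le> ?f n" "?f n \<le> 1" for n
    using monomial_bounds[of T "($) x" n] x by (auto simp: unit_cube_def)
  have r: "?f (restrict n T) = ?f n" for n
    by (intro prod.cong) auto
  have "Infinite_Set_Sum.abs_summable_on (\<lambda>n. pmf ?q n * ?f n) UNIV"
    by (rule abs_summable_on_comparison_test'[OF pmf_abs_summable[of ?q]])
      (use f in \<open>auto simp: abs_mult intro!: mult_left_le\<close>)
  then have "measure_pmf.expectation ?q ?f = (\<Sum>\<^sub>\<infinity>n\<in>UNIV. pmf ?q n * ?f n)"
    by (simp add: pmf_expectation_eq_infsetsum infsetsum_infsum)
  also have "\<dots> = (\<Sum>\<^sub>\<infinity>n\<in>T \<rightarrow>\<^sub>E UNIV. ?f n * pmf ?q n)"
  proof (rule infsum_cong_neutral)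
    fix n :: "'c \<Rightarrow> nat" assume "n \<in> UNIV - (T \<rightarrow>\<^sub>E UNIV)"
    then have "n \<notin> set_pmf ?q"
      by (auto simp: chi_marginal_def)
    then show "pmf ?q n * ?f n = 0"
      by (simp add: set_pmf_iff)
  qed auto
  finally show ?thesis
    by (simp add: gen_fun_def pgf_def chi_marginal_def r)
qed

lemma integrable_monomial [intro, simp]:
  fixes g :: "'c::finite \<Rightarrow> real" and X :: "('c \<Rightarrow> nat) pmf"
  assumes "\<And>k. k \<in> T \<Longrightarrow> 0 \<le> g k \<and> g k \<le> 1"
  shows "integrable (measure_pmf X) (\<lambda>n. \<Prod>k\<in>T. g k ^ n k)"
proof (rule measure_pmf.integrable_const_bound[where B = 1])
  have "norm (\<Prod>k\<in>T. g k ^ n k) \<le> 1" for n :: "'c \<Rightarrow> nat"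
    using monomial_bounds[of T g n] assms by auto
  then show "AE n in measure_pmf X. norm (\<Prod>k\<in>T. g k ^ n k) \<le> 1"
    by simp
qed simp

lemma integrable_indicator_pmf: "integrable (measure_pmf X) (indicator A :: 'a \<Rightarrow> real)"
  by (rule measure_pmf.integrable_const_bound[where B = 1]) (auto simp: indicator_def)

lemma pgf_mono:
  assumes "\<And>k. k \<in> T \<Longrightarrow> 0 \<le> x k" "\<And>k. k \<in> T \<Longrightarrow> x k \<le> y k" "\<And>k. k \<in> T \<Longrightarrow> y k \<le> 1"
  shows "pgf X T x \<le> pgf X T y"
  unfolding pgf_def
proof (rule integral_mono)
  show "integrable (measure_pmf X) (\<lambda>n. \<Prod>k\<in>T. x k ^ n k)"
       "integrable (measure_pmf X) (\<lambda>n. \<Prod>k\<in>T. y k ^ n k)"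
    using assms by (force intro!: integrable_monomial)+
qed (use assms in \<open>auto intro!: prod_mono power_mono\<close>)

abbreviation childless :: "('c::finite \<Rightarrow> nat) pmf \<Rightarrow> 'c set \<Rightarrow> real" where
  "childless X T \<equiv> measure_pmf.prob X {n. \<forall>k\<in>T. n k = 0}"

lemma monomial_zero:
  fixes n :: "'c::finite \<Rightarrow> nat"
  shows "(\<Prod>k\<in>T. (0::real) ^ n k) = of_bool (\<forall>k\<in>T. n k = 0)"
proof (cases "\<forall>k\<in>T. n k = 0")
  case False
  then obtain k where "k \<in> T" "n k \<noteq> 0"
    by blast
  then have "(\<Prod>k\<in>T. (0::real) ^ n k) = 0"
    by (intro prod_zero) auto
  then show ?thesis
    using False by simp
qed simp

lemma pgf_zero: "pgf X T (\<lambda>_. 0) = childless X T"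
proof -
  have "pgf X T (\<lambda>_. 0) = measure_pmf.expectation X (indicator {n. \<forall>k\<in>T. n k = 0})"
    unfolding pgf_def monomial_zero by (rule Bochner_Integration.integral_cong) (auto simp: indicator_def)
  then show ?thesis
    by simp
qed

text \<open>
  The monomial is \<open>1\<close> if no child has a colour in \<open>T\<close>, and at most \<open>1 - e\<close> otherwise.
\<close>

lemma pgf_constant_le:
  fixes X :: "('c::finite \<Rightarrow> nat) pmf"
  assumes e: "0 \<le> e" "e \<le> 1"
  shows "pgf X T (\<lambda>_. 1 - e) \<le> 1 - e * (1 - childless X T)"
proof -
  let ?A = "{n. \<forall>k\<in>T. n k = 0}"
  have pw: "(\<Prod>k\<in>T. (1 - e) ^ n k) \<le> (1 - e) + e * indicator ?A n" for n :: "'c \<Rightarrow> nat"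
  proof (cases "n \<in> ?A")
    case False
    then obtain k where k: "k \<in> T" "n k \<noteq> 0"
      by blast
    have "(\<Prod>k\<in>T. (1 - e) ^ n k) = (1 - e) ^ n k * (\<Prod>k\<in>T-{k}. (1 - e) ^ n k)"
      using k by (intro prod.remove) auto
    also have "\<dots> \<le> (1 - e) * 1"
    proof (rule mult_mono)
      show "(1 - e) ^ n k \<le> 1 - e"
        using power_decreasing[of 1 "n k" "1 - e"] k e by simp
      show "(\<Prod>k\<in>T-{k}. (1 - e) ^ n k) \<le> 1" "0 \<le> (\<Prod>k\<in>T-{k}. (1 - e) ^ n k)"
        using e by (auto intro!: monomial_bounds)
    qed (use e in auto)
    finally show ?thesis
      using False by simp
  qed simp
  have "pgf X T (\<lambda>_. 1 - e) \<le> measure_pmf.expectation X (\<lambda>n. (1 - e) + e * indicator ?A n)"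
    unfolding pgf_def using e pw
    by (intro integral_mono integrable_monomial Bochner_Integration.integrable_add
        integrable_mult_right integrable_indicator_pmf) auto
  also have "\<dots> = 1 - e * (1 - childless X T)"
    by (subst Bochner_Integration.integral_add)
      (auto intro!: integrable_indicator_pmf simp: algebra_simps)
  finally show ?thesis .
qed

text \<open>
  Every monomial increases from \<open>x\<close> to \<open>y\<close>. Keeping only the monomials that are a single coordinate
  leaves the sum on the left, which is the directional derivative at \<open>0\<close>.
\<close>

lemma pgf_increment_lower:
  fixes X :: "('c::finite \<Rightarrow> nat) pmf"
  assumes b: "\<And>k. k \<in> T \<Longrightarrow> 0 \<le> x k" "\<And>k. k \<in> T \<Longrightarrow> x k \<le> y k" "\<And>k. k \<in> T \<Longrightarrow> y k \<le> 1"
  shows "(\<Sum>k\<in>T. (y k - x k) * measure_pmf.prob X {n. n k = 1 \<and> (\<forall>l\<in>T-{k}. n l = 0)})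
      \<le> pgf X T y - pgf X T x"
proof -
  let ?A = "\<lambda>k. {n. n k = 1 \<and> (\<forall>l\<in>T-{k}. n l = 0)}"
  have pw: "(\<Sum>k\<in>T. (y k - x k) * indicator (?A k) n) \<le> (\<Prod>k\<in>T. y k ^ n k) - (\<Prod>k\<in>T. x k ^ n k)"
    for n :: "'c \<Rightarrow> nat"
  proof (cases "\<exists>k\<in>T. n \<in> ?A k")
    case True
    then obtain k where k: "k \<in> T" "n \<in> ?A k"
      by blast
    have "(\<Prod>l\<in>T. g l ^ n l) = g k" for g :: "'c \<Rightarrow> real"
      using k prod.remove[of T k "\<lambda>l. g l ^ n l"] by simp
    moreover have "(\<Sum>l\<in>T. (y l - x l) * indicator (?A l) n) = y k - x k"
    proof -
      have "(\<Sum>l\<in>T-{k}. (y l - x l) * indicator (?A l) n) = 0"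
        using k by (intro sum.neutral) auto
      then show ?thesis
        using k sum.remove[of T k "\<lambda>l. (y l - x l) * indicator (?A l) n"] by simp
    qed
    ultimately show ?thesis
      by simp
  next
    case False
    then have "(\<Sum>k\<in>T. (y k - x k) * indicator (?A k) n) = 0"
      by (intro sum.neutral) auto
    moreover have "(\<Prod>k\<in>T. x k ^ n k) \<le> (\<Prod>k\<in>T. y k ^ n k)"
      using b by (intro prod_mono) (auto intro!: power_mono)
    ultimately show ?thesis
      by simp
  qed
  have int: "integrable (measure_pmf X) (\<lambda>n. (y k - x k) * indicator (?A k) n)" for k
    by (intro integrable_mult_right integrable_indicator_pmf)
  have intp: "integrable (measure_pmf X) (\<lambda>n. \<Prod>k\<in>T. x k ^ n k)"
       "integrable (measure_pmf X) (\<lambda>n. \<Prod>k\<in>T. y k ^ n k)"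
    using b by (force intro!: integrable_monomial)+
  have "measure_pmf.expectation X (\<lambda>n. (y k - x k) * indicator (?A k) n) =
      (y k - x k) * measure_pmf.prob X (?A k)" for k
    by simp
  then have "(\<Sum>k\<in>T. (y k - x k) * measure_pmf.prob X (?A k)) =
      measure_pmf.expectation X (\<lambda>n. \<Sum>k\<in>T. (y k - x k) * indicator (?A k) n)"
    by (subst Bochner_Integration.integral_sum[OF int]) (simp only:)
  also have "\<dots> \<le> measure_pmf.expectation X (\<lambda>n. (\<Prod>k\<in>T. y k ^ n k) - (\<Prod>k\<in>T. x k ^ n k))"
    by (intro integral_mono Bochner_Integration.integrable_sum
        Bochner_Integration.integrable_diff int intp pw)
  also have "\<dots> = pgf X T y - pgf X T x"
    unfolding pgf_def using intp by simp
  finally show ?thesis .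
qed

text \<open>
  Only an upward change has to be estimated, so \<open>y\<close> may also lie far below \<open>x\<close>. The bound is the mean
  value estimate with the derivative at \<open>1\<close>.
\<close>

lemma power_increment_upper:
  fixes x y b :: real
  assumes "0 \<le> x" "x \<le> 1" "0 \<le> y" "y \<le> 1" "0 \<le> b" "y \<le> x + b"
  shows "y ^ n \<le> x ^ n + real n * b"
proof (induction n)
  case (Suc n)
  have "y ^ Suc n - x ^ Suc n = (y - x) * y ^ n + x * (y ^ n - x ^ n)"
    by (simp add: algebra_simps)
  also have "\<dots> \<le> b * 1 + 1 * (real n * b)"
  proof (rule add_mono)
    have "(y - x) * y ^ n \<le> b * y ^ n"
      using assms by (intro mult_right_mono) auto
    also have "\<dots> \<le> b * 1"
      using assms by (intro mult_left_mono power_le_one)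
    finally show "(y - x) * y ^ n \<le> b * 1" .
    have "x * (y ^ n - x ^ n) \<le> x * (real n * b)"
      using assms Suc by (intro mult_left_mono) auto
    also have "\<dots> \<le> 1 * (real n * b)"
      using assms by (intro mult_right_mono) auto
    finally show "x * (y ^ n - x ^ n) \<le> 1 * (real n * b)" .
  qed
  finally show ?case
    by (simp add: algebra_simps)
qed simp

lemma monomial_increment_upper:
  fixes x y b :: "'c \<Rightarrow> real"
  assumes "finite T"
    and "\<And>k. k \<in> T \<Longrightarrow> 0 \<le> x k \<and> x k \<le> 1 \<and> 0 \<le> y k \<and> y k \<le> 1 \<and> 0 \<le> b k \<and> y k \<le> x k + b k"
  shows "(\<Prod>k\<in>T. y k ^ n k) \<le> (\<Prod>k\<in>T. x k ^ n k) + (\<Sum>k\<in>T. b k * real (n k))"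
  using assms
proof (induction T rule: finite_induct)
  case (insert a T)
  let ?Y = "\<Prod>k\<in>T. y k ^ n k" and ?X = "\<Prod>k\<in>T. x k ^ n k" and ?s = "\<Sum>k\<in>T. b k * real (n k)"
  have IH: "?Y \<le> ?X + ?s"
    using insert by auto
  have a: "y a ^ n a \<le> x a ^ n a + real (n a) * b a"
    using insert.prems[of a] by (intro power_increment_upper) auto
  have Y: "0 \<le> ?Y" "?Y \<le> 1"
    using insert.prems by (auto intro!: monomial_bounds)
  have s: "0 \<le> ?s"
    using insert.prems by (intro sum_nonneg) auto
  have xa: "0 \<le> x a ^ n a" "x a ^ n a \<le> 1" "0 \<le> real (n a) * b a"
    using insert.prems[of a] by (auto intro!: power_le_one)
  have "y a ^ n a * ?Y \<le> (x a ^ n a + real (n a) * b a) * ?Y"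
    using a Y by (intro mult_right_mono)
  also have "\<dots> = x a ^ n a * ?Y + real (n a) * b a * ?Y"
    by (simp add: algebra_simps)
  also have "\<dots> \<le> x a ^ n a * (?X + ?s) + real (n a) * b a * 1"
    using IH Y xa by (intro add_mono mult_left_mono)
  also have "\<dots> \<le> x a ^ n a * ?X + 1 * ?s + real (n a) * b a"
    using mult_right_mono[OF xa(2) s] by (simp add: algebra_simps)
  finally show ?case
    using insert.hyps by (simp add: algebra_simps)
qed simp

lemma ennreal_pgf:
  fixes X :: "('c::finite \<Rightarrow> nat) pmf"
  assumes "\<And>k. k \<in> T \<Longrightarrow> 0 \<le> g k \<and> g k \<le> 1"
  shows "ennreal (pgf X T g) = (\<integral>\<^sup>+n. ennreal (\<Prod>k\<in>T. g k ^ n k) \<partial>measure_pmf X)"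
  unfolding pgf_def
  by (rule nn_integral_eq_integral[symmetric])
    (use assms in \<open>auto intro!: monomial_bounds AE_I2\<close>)

text \<open>
  The offspring means are the partial derivatives of the generating function at \<open>1\<close>. They may be
  infinite, so the estimate is stated for extended reals, where an infinite mean with \<open>b k = 0\<close>
  contributes nothing.
\<close>

lemma pgf_increment_upper:
  fixes X :: "('c::finite \<Rightarrow> nat) pmf"
  assumes b: "\<And>k. k \<in> T \<Longrightarrow> 0 \<le> x k \<and> x k \<le> 1 \<and> 0 \<le> y k \<and> y k \<le> 1 \<and> 0 \<le> b k \<and> y k \<le> x k + b k"
  shows "ennreal (pgf X T y) \<le>
      ennreal (pgf X T x) + (\<Sum>k\<in>T. ennreal (b k) * (\<integral>\<^sup>+n. ennreal (real (n k)) \<partial>measure_pmf X))"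
proof -
  have "ennreal (pgf X T y) = (\<integral>\<^sup>+n. ennreal (\<Prod>k\<in>T. y k ^ n k) \<partial>measure_pmf X)"
    using b by (intro ennreal_pgf) auto
  also have "\<dots> \<le> (\<integral>\<^sup>+n. ennreal (\<Prod>k\<in>T. x k ^ n k) +
      (\<Sum>k\<in>T. ennreal (b k) * ennreal (real (n k))) \<partial>measure_pmf X)"
  proof (rule nn_integral_mono)
    fix n :: "'c \<Rightarrow> nat"
    have "ennreal (\<Prod>k\<in>T. y k ^ n k) \<le> ennreal ((\<Prod>k\<in>T. x k ^ n k) + (\<Sum>k\<in>T. b k * real (n k)))"
      using b by (intro ennreal_leI monomial_increment_upper) auto
    also have "\<dots> = ennreal (\<Prod>k\<in>T. x k ^ n k) + (\<Sum>k\<in>T. ennreal (b k * real (n k)))"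
      using b by (subst ennreal_plus) (auto intro!: monomial_bounds sum_nonneg simp: sum_ennreal)
    also have "(\<Sum>k\<in>T. ennreal (b k * real (n k))) = (\<Sum>k\<in>T. ennreal (b k) * ennreal (real (n k)))"
      using b by (intro sum.cong) (auto simp: ennreal_mult)
    finally show "ennreal (\<Prod>k\<in>T. y k ^ n k) \<le>
       ennreal (\<Prod>k\<in>T. x k ^ n k) + (\<Sum>k\<in>T. ennreal (b k) * ennreal (real (n k)))" .
  qed
  also have "\<dots> = (\<integral>\<^sup>+n. ennreal (\<Prod>k\<in>T. x k ^ n k) \<partial>measure_pmf X) +
      (\<Sum>k\<in>T. ennreal (b k) * (\<integral>\<^sup>+n. ennreal (real (n k)) \<partial>measure_pmf X))"
    by (simp add: nn_integral_add nn_integral_sum nn_integral_cmult)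
  also have "(\<integral>\<^sup>+n. ennreal (\<Prod>k\<in>T. x k ^ n k) \<partial>measure_pmf X) = ennreal (pgf X T x)"
    using b by (intro ennreal_pgf[symmetric]) auto
  finally show ?thesis .
qed

text \<open>
  A monomial is in general not convex on the cube (consider \<open>x y\<close>). In a direction with nonnegative
  entries it is a product of nonnegative, nondecreasing, affine functions, and products of
  nonnegative, nondecreasing, convex functions are convex.
\<close>

lemma monomial_convex_on_segment:
  fixes x d :: "'c \<Rightarrow> real"
  assumes "finite T" "\<And>k. k \<in> T \<Longrightarrow> 0 \<le> x k" "\<And>k. k \<in> T \<Longrightarrow> 0 \<le> d k"
  shows "convex_on {0..1} (\<lambda>t. \<Prod>k\<in>T. (x k + t * d k) ^ n k)"
proof -
  define Good where "Good f \<longleftrightarrow>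
      convex_on {0..1::real} f \<and> mono_on {0..1} f \<and> f \<in> {0..1} \<rightarrow> {0::real..}" for f
  have mult: "Good (\<lambda>t. f t * g t)" if "Good f" "Good g" for f g
    using that unfolding Good_def
    by (auto intro!: convex_on_mul mono_onI mult_mono dest: mono_onD simp: Pi_iff)
  have one: "Good (\<lambda>_. 1)"
    by (auto simp: Good_def convex_on_def mono_on_def)
  have aff: "Good (\<lambda>t. x k + t * d k)" if "k \<in> T" for k
    using assms that
    by (auto simp: Good_def mono_on_def convex_on_def algebra_simps mult_right_mono
        simp flip: distrib_right distrib_left)
  have pow: "Good (\<lambda>t. (x k + t * d k) ^ m)" if "k \<in> T" for k m
    by (induction m) (use aff[OF that] one mult in auto)
  have "Good (\<lambda>t. \<Prod>k\<in>U. (x k + t * d k) ^ n k)" if "finite U" "U \<subseteq> T" for U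
    using that by (induction U rule: finite_induct) (use pow one mult in auto)
  then show ?thesis
    using assms(1) by (auto simp: Good_def)
qed

lemma pgf_convex_on_segment:
  fixes X :: "('c::finite \<Rightarrow> nat) pmf"
  assumes b: "\<And>k. k \<in> T \<Longrightarrow> 0 \<le> x k \<and> x k \<le> y k \<and> y k \<le> 1" and t: "0 \<le> t" "t \<le> 1"
  shows "pgf X T (\<lambda>k. x k + t * (y k - x k)) \<le> pgf X T x + t * (pgf X T y - pgf X T x)"
proof -
  have pw: "(\<Prod>k\<in>T. (x k + t * (y k - x k)) ^ n k) \<le>
      (1 - t) * (\<Prod>k\<in>T. x k ^ n k) + t * (\<Prod>k\<in>T. y k ^ n k)" for n
    using convex_onD[OF monomial_convex_on_segment[of T x "\<lambda>k. y k - x k" n], of t 0 1] b t by simp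
  have seg: "0 \<le> x k + t * (y k - x k) \<and> x k + t * (y k - x k) \<le> 1" if "k \<in> T" for k
  proof -
    have "t * (y k - x k) \<le> 1 * (y k - x k)"
      using b[OF that] t by (intro mult_right_mono) auto
    then show ?thesis
      using b[OF that] t by auto
  qed
  have intp: "integrable (measure_pmf X) (\<lambda>n. \<Prod>k\<in>T. x k ^ n k)"
       "integrable (measure_pmf X) (\<lambda>n. \<Prod>k\<in>T. y k ^ n k)"
       "integrable (measure_pmf X) (\<lambda>n. \<Prod>k\<in>T. (x k + t * (y k - x k)) ^ n k)"
    using b seg by (force intro!: integrable_monomial)+
  have "pgf X T (\<lambda>k. x k + t * (y k - x k)) \<le> measure_pmf.expectation X
      (\<lambda>n. (1 - t) * (\<Prod>k\<in>T. x k ^ n k) + t * (\<Prod>k\<in>T. y k ^ n k))"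
    unfolding pgf_def using intp pw by (intro integral_mono) auto
  also have "\<dots> = (1 - t) * pgf X T x + t * pgf X T y"
    unfolding pgf_def using intp by simp
  finally show ?thesis
    by (simp add: algebra_simps)
qed

section \<open>Tangents of generating functions on the cube\<close>

text \<open>
  The parameter runs through the whole unit interval and the derivative is taken at an arbitrary
  point \<open>s\<close> of it, so that the same chain rule serves for the coordinate lines in the definition of
  \<open>partial\<close> and for segments starting at \<open>x\<close>.
\<close>

lemma has_derivative_on_cube_segment:
  fixes f :: "real ^ 'c::finite \<Rightarrow> real"
  assumes D: "(f has_derivative D) (at x within unit_cube)"
    and seg: "\<And>t. t \<in> {0..1} \<Longrightarrow> x + (t - s) *\<^sub>R d \<in> unit_cube" and s: "s \<in> {0..1}"
  shows "((\<lambda>t. f (x + (t - s) *\<^sub>R d)) has_field_derivative D d) (at s within {0..1})"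
proof -
  have "((\<lambda>t. x + (t - s) *\<^sub>R d) has_derivative (\<lambda>h. h *\<^sub>R d)) (at s within {0..1})"
    by (auto intro!: derivative_eq_intros)
  moreover have "(f has_derivative D) (at (x + (s - s) *\<^sub>R d) within (\<lambda>t. x + (t - s) *\<^sub>R d) ` {0..1})"
    by (rule has_derivative_subset[of f D _ unit_cube]) (use D seg in auto)
  ultimately have "((\<lambda>t. f (x + (t - s) *\<^sub>R d)) has_derivative (\<lambda>h. D (h *\<^sub>R d))) (at s within {0..1})"
    by (rule has_derivative_in_compose)
  moreover have "(\<lambda>h. D (h *\<^sub>R d)) = (*) (D d)"
    using has_derivative_linear[OF D] by (auto simp: linear_cmul mult.commute)
  ultimately show ?thesis
    by (simp add: has_field_derivative_def)
qed

lemma has_partial: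
  fixes f :: "real ^ 'c::finite \<Rightarrow> real"
  assumes D: "(f has_derivative D) (at x within unit_cube)" and x: "x \<in> unit_cube"
  shows "((\<lambda>t. f (\<chi> l. if l = k then t else x $ l)) has_field_derivative D (axis k 1))
       (at (x $ k) within {0..1})"
    and "partial k f x = D (axis k 1)"
proof -
  have c: "x + (t - x $ k) *\<^sub>R axis k 1 = (\<chi> l. if l = k then t else x $ l)" for t
    by (simp add: vec_eq_iff axis_def)
  have s: "x $ k \<in> {0..1}"
    using x by (simp add: unit_cube_def)
  show 1: "((\<lambda>t. f (\<chi> l. if l = k then t else x $ l)) has_field_derivative D (axis k 1))
       (at (x $ k) within {0..1})"
    using has_derivative_on_cube_segment[OF D _ s, of "axis k 1"] x
    unfolding c by (auto simp: unit_cube_def)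
  show "partial k f x = D (axis k 1)"
    unfolding partial_def
    by (rule vector_derivative_within_closed_interval[OF _ s])
      (use 1 in \<open>auto simp: has_real_derivative_iff_has_vector_derivative\<close>)
qed

lemma derivative_eq_sum_partial:
  fixes f :: "real ^ 'c::finite \<Rightarrow> real"
  assumes D: "(f has_derivative D) (at x within unit_cube)" and x: "x \<in> unit_cube"
  shows "D d = (\<Sum>k\<in>UNIV. d $ k * partial k f x)"
proof -
  have lin: "linear D"
    using D by (rule has_derivative_linear)
  have "D d = D (\<Sum>k\<in>UNIV. (d $ k) *s axis k 1)"
    by (simp add: basis_expansion)
  also have "\<dots> = (\<Sum>k\<in>UNIV. d $ k * D (axis k 1))"
    using lin by (simp add: linear_sum linear_cmul scalar_mult_eq_scaleR)
  finally show ?thesis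
    by (simp add: has_partial(2)[OF D x])
qed

text \<open>
  On the segment from \<open>x\<close> to \<open>y\<close> the generating function lies below its chord; letting the parameter
  tend to \<open>0\<close> compares the slope at \<open>x\<close> with that of the chord.
\<close>

lemma gen_fun_tangent:
  fixes chi :: "'c::finite \<Rightarrow> ('c \<Rightarrow> nat) pmf"
  assumes diff: "gen_fun chi j T differentiable_on unit_cube"
    and x: "x \<in> unit_cube" and y: "y \<in> unit_cube" and le: "\<And>k. k \<in> T \<Longrightarrow> x $ k \<le> y $ k"
  shows "(\<Sum>k\<in>T. (y $ k - x $ k) * partial k (gen_fun chi j T) x) \<le> gen_fun chi j T y - gen_fun chi j T x"
proof -
  let ?G = "gen_fun chi j T"
  \<comment> \<open>Coordinates outside \<open>T\<close> do not influence the function, and \<open>y\<close> need not lie above \<open>x\<close> there.\<close>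
  define d where "d = (\<chi> k. if k \<in> T then y $ k - x $ k else 0)"
  obtain D where D: "(?G has_derivative D) (at x within unit_cube)"
    using diff x by (auto simp: differentiable_on_def differentiable_def)
  have seg: "x + t *\<^sub>R d \<in> unit_cube" if "t \<in> {0..1}" for t
  proof -
    have "0 \<le> x $ k + t * d $ k \<and> x $ k + t * d $ k \<le> 1" for k
    proof -
      have xy: "0 \<le> x $ k" "x $ k \<le> 1" "y $ k \<le> 1"
        using x y by (auto simp: unit_cube_def)
      have d: "0 \<le> d $ k" "d $ k \<le> 1 - x $ k"
        using le[of k] xy by (auto simp: d_def)
      have "t * d $ k \<le> 1 * d $ k"
        using that d by (intro mult_right_mono) auto
      then show ?thesis
        using d xy that by auto
    qed
    then show ?thesis
      by (simp add: unit_cube_def)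
  qed
  have conv: "?G (x + t *\<^sub>R d) \<le> ?G x + t * (?G y - ?G x)" if t: "t \<in> {0..1}" for t
  proof -
    have "pgf (chi j) T (($) (x + t *\<^sub>R d)) = pgf (chi j) T (\<lambda>k. x $ k + t * (y $ k - x $ k))"
      unfolding pgf_def
      by (intro Bochner_Integration.integral_cong refl prod.cong) (simp_all add: d_def)
    also have "\<dots> \<le> pgf (chi j) T (($) x) + t * (pgf (chi j) T (($) y) - pgf (chi j) T (($) x))"
      using t x y le by (intro pgf_convex_on_segment) (auto simp: unit_cube_def)
    finally show ?thesis
      using seg[OF t] x y by (simp add: gen_fun_eq_pgf)
  qed
  have "((\<lambda>t. ?G (x + (t - 0) *\<^sub>R d)) has_field_derivative D d) (at 0 within {0..1})"
    by (rule has_derivative_on_cube_segment[OF D]) (use seg in auto)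
  then have "((\<lambda>t. (?G (x + t *\<^sub>R d) - ?G x) / t) \<longlongrightarrow> D d) (at 0 within {0..1})"
    by (simp add: has_field_derivative_iff)
  moreover have "\<forall>\<^sub>F t in at 0 within {0..1}. (?G (x + t *\<^sub>R d) - ?G x) / t \<le> ?G y - ?G x"
    using conv by (auto simp: eventually_at_filter field_simps intro!: always_eventually)
  moreover have "at (0::real) within {0..1} \<noteq> bot"
    by (simp add: trivial_limit_within)
  ultimately have "D d \<le> ?G y - ?G x"
    by (rule tendsto_upperbound)
  moreover have "D d = (\<Sum>k\<in>T. (y $ k - x $ k) * partial k ?G x)"
    unfolding derivative_eq_sum_partial[OF D x]
    by (rule sum.mono_neutral_cong_right) (auto simp: d_def)
  ultimately show ?thesis
    by simp
qed

lemma partial_gen_fun_nonneg: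
  fixes chi :: "'c::finite \<Rightarrow> ('c \<Rightarrow> nat) pmf"
  assumes diff: "gen_fun chi j T differentiable_on unit_cube" and x: "x \<in> unit_cube"
  shows "0 \<le> partial k (gen_fun chi j T) x"
proof -
  let ?G = "gen_fun chi j T" and ?c = "\<lambda>t. (\<chi> l. if l = k then t else x $ l)"
  obtain D where D: "(?G has_derivative D) (at x within unit_cube)"
    using diff x by (auto simp: differentiable_on_def differentiable_def)
  have xk: "x $ k \<in> {0..1}"
    using x by (simp add: unit_cube_def)
  have cube: "?c t \<in> unit_cube" if "t \<in> {0..1}" for t
    using x that by (simp add: unit_cube_def)
  have mono: "?G (?c s) \<le> ?G (?c t)" if "s \<in> {0..1}" "t \<in> {0..1}" "s \<le> t" for s t
    using that x cube[of s] cube[of t]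
    by (simp add: gen_fun_eq_pgf) (rule pgf_mono; simp add: unit_cube_def)
  have cx: "?c (x $ k) = x"
    by (simp add: vec_eq_iff)
  have "((\<lambda>t. (?G (?c t) - ?G (?c (x $ k))) / (t - x $ k)) \<longlongrightarrow> partial k ?G x) (at (x $ k) within {0..1})"
    using has_partial[OF D x, of k] unfolding has_field_derivative_iff by simp
  moreover have "0 \<le> (?G (?c t) - ?G (?c (x $ k))) / (t - x $ k)" if "t \<in> {0..1}" for t
    using mono[of t "x $ k"] mono[of "x $ k" t] that xk
    by (cases "t \<le> x $ k") (auto intro: divide_nonpos_nonpos divide_nonneg_nonneg)
  then have "\<forall>\<^sub>F t in at (x $ k) within {0..1}. 0 \<le> (?G (?c t) - ?G (?c (x $ k))) / (t - x $ k)"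
    by (auto simp: eventually_at_filter intro!: always_eventually)
  moreover have "at (x $ k) within {0..1} \<noteq> bot"
    using xk by (simp add: trivial_limit_within islimpt_Icc)
  ultimately show ?thesis
    by (rule tendsto_lowerbound)
qed

section \<open>Recursions for the outcome probabilities\<close>

lemma rooted_prob_bounds [simp]: "0 \<le> rooted_prob chi j E" "rooted_prob chi j E \<le> 1"
  using prob_space.prob_le_1[OF prob_space_gw_rooted] by (auto simp: rooted_prob_def)

lemma rooted_prob_cong:
  assumes "Measurable.pred sample_space E" "Measurable.pred sample_space E'"
    and "\<And>X. E (j, X) \<longleftrightarrow> E' (j, X)"
  shows "rooted_prob chi j E = rooted_prob chi j E'"
  using assms by (simp add: rooted_prob_eq)

lemma rooted_prob_mono:
  assumes "Measurable.pred sample_space E'" "\<And>\<omega>. E \<omega> \<Longrightarrow> E' \<omega>"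
  shows "rooted_prob chi j E \<le> rooted_prob chi j E'"
proof -
  interpret prob_space "gw_rooted chi j"
    by (rule prob_space_gw_rooted)
  show ?thesis
    unfolding rooted_prob_def
    by (rule finite_measure_mono) (use assms in \<open>auto simp: sets_gw_rooted pred_def\<close>)
qed

lemma rooted_prob_not:
  assumes "Measurable.pred sample_space E"
  shows "rooted_prob chi j (\<lambda>\<omega>. \<not> E \<omega>) = 1 - rooted_prob chi j E"
proof -
  interpret prob_space "gw_rooted chi j"
    by (rule prob_space_gw_rooted)
  have "{\<omega>. E \<omega>} \<in> events"
    using assms by (simp add: sets_gw_rooted pred_def)
  then show ?thesis
    using prob_compl[of "{\<omega>. E \<omega>}"] by (simp add: rooted_prob_def space_gw_rooted Compl_eq_Diff_UNIV[symmetric] Collect_neg_eq)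
qed

lemma rooted_prob_no_children:
  "rooted_prob chi j (\<lambda>\<omega>. \<forall>k\<in>T. snd \<omega> [] k = 0) = childless (chi j) T"
proof -
  have *: "(\<forall>m. \<not> m < a) \<longleftrightarrow> a = 0" for a :: nat
    by auto
  show ?thesis
    using rooted_prob_all_children[of "\<lambda>_. False" chi j T]
    by (simp add: * rooted_prob_def pgf_zero)
qed

text \<open>
  A root without children in \<open>T\<close> satisfies the universal condition vacuously. If this is to count as
  failure, the event has to be removed.
\<close>

lemma rooted_prob_responder:
  fixes chi :: "'c::finite \<Rightarrow> ('c \<Rightarrow> nat) pmf"
  assumes Q: "Measurable.pred sample_space Q"
  shows "rooted_prob chi j
      (\<lambda>\<omega>. if \<forall>k\<in>T. snd \<omega> [] k = 0 then a else \<forall>k\<in>T. \<forall>m<snd \<omega> [] k. Q (subtree (k, m) \<omega>)) =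
    pgf (chi j) T (\<lambda>k. rooted_prob chi k Q) - of_bool (\<not> a) * childless (chi j) T" (is "?L = ?R")
proof -
  let ?none = "\<lambda>\<omega>::'c sample. \<forall>k\<in>T. snd \<omega> [] k = 0"
  let ?all = "\<lambda>\<omega>. \<forall>k\<in>T. \<forall>m<snd \<omega> [] k. Q (subtree (k, m) \<omega>)"
  interpret prob_space "gw_rooted chi j"
    by (rule prob_space_gw_rooted)
  have "{\<omega>. ?none \<omega>} \<in> events" "{\<omega>. ?all \<omega>} \<in> events"
    using pred_no_children[of T] pred_all_children[OF Q, of T] by (simp_all add: sets_gw_rooted pred_def)
  moreover have "{\<omega>. ?none \<omega>} \<subseteq> {\<omega>. ?all \<omega>}"
    by auto
  ultimately have diff: "prob ({\<omega>. ?all \<omega>} - {\<omega>. ?none \<omega>}) = prob {\<omega>. ?all \<omega>} - prob {\<omega>. ?none \<omega>}"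
    by (intro finite_measure_Diff)
  have "{\<omega>. if ?none \<omega> then a else ?all \<omega>} = {\<omega>. ?all \<omega>} - (if a then {} else {\<omega>. ?none \<omega>})"
    by auto
  then have "?L = prob {\<omega>. ?all \<omega>} - of_bool (\<not> a) * prob {\<omega>. ?none \<omega>}"
    by (simp add: rooted_prob_def diff)
  then show ?thesis
    using rooted_prob_all_children[OF Q, of chi j T] rooted_prob_no_children[of chi j T]
    by (simp add: rooted_prob_def)
qed

text \<open>
  Failure of the player to move is the event of the preceding lemma for the complementary property.
\<close>

lemma rooted_prob_mover:
  fixes chi :: "'c::finite \<Rightarrow> ('c \<Rightarrow> nat) pmf"
  assumes Q: "Measurable.pred sample_space Q"
  shows "rooted_prob chi j
      (\<lambda>\<omega>. if \<forall>k\<in>T. snd \<omega> [] k = 0 then a else \<exists>k\<in>T. \<exists>m<snd \<omega> [] k. Q (subtree (k, m) \<omega>)) =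
    1 - pgf (chi j) T (\<lambda>k. 1 - rooted_prob chi k Q) + of_bool a * childless (chi j) T"
proof -
  let ?E = "\<lambda>\<omega>. if \<forall>k\<in>T. snd \<omega> [] k = 0 then \<not> a else \<forall>k\<in>T. \<forall>m<snd \<omega> [] k. \<not> Q (subtree (k, m) \<omega>)"
  have nQ: "Measurable.pred sample_space (\<lambda>\<omega>. \<not> Q \<omega>)"
    using Q by measurable
  have "Measurable.pred sample_space ?E"
    using pred_all_children[OF nQ, of T] pred_no_children[of T] by measurable
  moreover have "(\<lambda>\<omega>. if \<forall>k\<in>T. snd \<omega> [] k = 0 then a else \<exists>k\<in>T. \<exists>m<snd \<omega> [] k. Q (subtree (k, m) \<omega>)) =
      (\<lambda>\<omega>. \<not> ?E \<omega>)"
    by auto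
  ultimately show ?thesis
    using rooted_prob_responder[OF nQ, of chi j T "\<not> a"]
    by (simp only: rooted_prob_not rooted_prob_not[OF Q] not_not)
qed

lemma pred_cases_children:
  fixes T :: "'c::finite set"
  assumes Q: "Measurable.pred sample_space Q"
  shows "Measurable.pred sample_space (\<lambda>\<omega>. if \<forall>k\<in>T. snd \<omega> [] k = 0 then a
      else \<forall>k\<in>T. \<forall>m<snd \<omega> [] k. Q (subtree (k, m) \<omega>))" (is ?all)
    and "Measurable.pred sample_space (\<lambda>\<omega>. if \<forall>k\<in>T. snd \<omega> [] k = 0 then a
      else \<exists>k\<in>T. \<exists>m<snd \<omega> [] k. Q (subtree (k, m) \<omega>))" (is ?ex)
proof -
  show ?all
    using pred_all_children[OF Q, of T] pred_no_children[of T] by measurable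
  have "Measurable.pred sample_space (\<lambda>\<omega>. \<not> Q \<omega>)"
    using Q by measurable
  from pred_all_children[OF this, of T]
  have "Measurable.pred sample_space (\<lambda>\<omega>. \<not> (\<forall>k\<in>T. \<forall>m<snd \<omega> [] k. \<not> Q (subtree (k, m) \<omega>)))"
    by measurable
  then show ?ex
    using pred_no_children[of T] by simp
qed

definition forced_prob ::
    "('c::finite \<Rightarrow> ('c \<Rightarrow> nat) pmf) \<Rightarrow> ('c \<Rightarrow> 'c set) \<Rightarrow> player \<Rightarrow> (player \<Rightarrow> bool) \<Rightarrow> player \<Rightarrow> 'c \<Rightarrow> real" where
  "forced_prob chi S q A r j = rooted_prob chi j (\<lambda>\<omega>. forces (moves S \<omega>) q A r [])"

definition forced_prob_in ::
    "('c::finite \<Rightarrow> ('c \<Rightarrow> nat) pmf) \<Rightarrow> ('c \<Rightarrow> 'c set) \<Rightarrow> player \<Rightarrow> (player \<Rightarrow> bool) \<Rightarrow> nat \<Rightarrow> player \<Rightarrow> 'c \<Rightarrow> real" where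
  "forced_prob_in chi S q A n r j = rooted_prob chi j (\<lambda>\<omega>. forces_in (moves S \<omega>) q A n r [])"

lemma forced_prob_bounds [simp]:
  "0 \<le> forced_prob chi S q A r j" "forced_prob chi S q A r j \<le> 1"
  "0 \<le> forced_prob_in chi S q A n r j" "forced_prob_in chi S q A n r j \<le> 1"
  by (simp_all add: forced_prob_def forced_prob_in_def)

lemma forced_prob_mover:
  "forced_prob chi S q A q j =
    1 - pgf (chi j) (allowed S q j) (\<lambda>k. 1 - forced_prob chi S q A (opponent q) k) +
    of_bool (A q) * childless (chi j) (allowed S q j)"
  unfolding forced_prob_def
  by (subst rooted_prob_mover[OF pred_forces, symmetric],
      rule rooted_prob_cong[OF pred_forces pred_cases_children(2)[OF pred_forces]],
      subst forces_root, simp)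

lemma forced_prob_responder:
  "forced_prob chi S q A (opponent q) j =
    pgf (chi j) (allowed S (opponent q) j) (forced_prob chi S q A q) -
    of_bool (\<not> A (opponent q)) * childless (chi j) (allowed S (opponent q) j)"
  unfolding forced_prob_def
  by (subst rooted_prob_responder[OF pred_forces, symmetric],
      rule rooted_prob_cong[OF pred_forces pred_cases_children(1)[OF pred_forces]],
      subst forces_root, simp)

lemma forced_prob_in_mover:
  "forced_prob_in chi S q A (Suc n) q j =
    1 - pgf (chi j) (allowed S q j) (\<lambda>k. 1 - forced_prob_in chi S q A n (opponent q) k) +
    of_bool (A q) * childless (chi j) (allowed S q j)"
  unfolding forced_prob_in_def
  by (subst rooted_prob_mover[OF pred_forces_in, symmetric],
      rule rooted_prob_cong[OF pred_forces_in pred_cases_children(2)[OF pred_forces_in]],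
      subst forces_in_root, simp)

lemma forced_prob_in_responder:
  "forced_prob_in chi S q A (Suc n) (opponent q) j =
    pgf (chi j) (allowed S (opponent q) j) (forced_prob_in chi S q A n q) -
    of_bool (\<not> A (opponent q)) * childless (chi j) (allowed S (opponent q) j)"
  unfolding forced_prob_in_def
  by (subst rooted_prob_responder[OF pred_forces_in, symmetric],
      rule rooted_prob_cong[OF pred_forces_in pred_cases_children(1)[OF pred_forces_in]],
      subst forces_in_root, simp)

lemma forced_prob_in_0 [simp]: "forced_prob_in chi S q A 0 r j = 0"
  by (simp add: forced_prob_in_def rooted_prob_def)

text \<open>
  Even bounds suffice since success within \<open>n\<close> is monotone in \<open>n\<close>. An induction over pairs of rounds
  returns to the player who moved first, and thus compares a vector of probabilities with itself.
\<close>

lemma forced_prob_le: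
  fixes chi :: "'c::finite \<Rightarrow> ('c \<Rightarrow> nat) pmf"
  assumes "\<And>n. forced_prob_in chi S q A (2 * n) r j \<le> c"
  shows "forced_prob chi S q A r j \<le> c"
proof -
  interpret prob_space "gw_rooted chi j"
    by (rule prob_space_gw_rooted)
  let ?E = "\<lambda>n. {\<omega>. forces_in (moves S \<omega>) q A n r []}"
  have "range ?E \<subseteq> events"
    using pred_forces_in by (auto simp: sets_gw_rooted pred_def)
  moreover have "incseq ?E"
    by (auto simp: incseq_def intro: forces_in_mono)
  ultimately have "(\<lambda>n. prob (?E n)) \<longlonglongrightarrow> prob (\<Union>n. ?E n)"
    by (rule finite_Lim_measure_incseq)
  moreover have "prob (?E n) \<le> c" for n
  proof -
    have "rooted_prob chi j (\<lambda>\<omega>. forces_in (moves S \<omega>) q A n r []) \<le>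
        rooted_prob chi j (\<lambda>\<omega>. forces_in (moves S \<omega>) q A (2 * n) r [])"
      by (rule rooted_prob_mono[OF pred_forces_in]) (rule forces_in_mono, auto)
    then show ?thesis
      using assms[of n] by (simp add: forced_prob_in_def rooted_prob_def)
  qed
  ultimately have "prob (\<Union>n. ?E n) \<le> c"
    by (intro LIMSEQ_le_const2) auto
  moreover have "(\<Union>n. ?E n) = {\<omega>. forces (moves S \<omega>) q A r []}"
    by (auto simp: forces_def)
  ultimately show ?thesis
    by (simp add: forced_prob_def rooted_prob_def)
qed

lemma forced_prob_mono:
  assumes "\<And>r. A r \<Longrightarrow> B r"
  shows "forced_prob chi S q A r j \<le> forced_prob chi S q B r j"
proof -
  have "forces_in mv q A n r v \<Longrightarrow> forces_in mv q B n r v" for mv n r and v :: "'a vertex"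
    by (induction n arbitrary: r v) (auto simp: assms split: if_splits)
  then show ?thesis
    unfolding forced_prob_def by (intro rooted_prob_mono pred_forces) (unfold forces_def, blast)
qed

lemma normal_win_iff:
  fixes \<omega> :: "'c::finite sample"
  shows "normal_win (moves S \<omega>) i v q \<longleftrightarrow> forces (moves S \<omega>) q (\<lambda>r. r = opponent q) i v"
  unfolding normal_win_def by (rule can_force_iff_forces) (rule finite_moves)

lemma misere_win_iff:
  fixes \<omega> :: "'c::finite sample"
  shows "misere_win (moves S \<omega>) i v q \<longleftrightarrow> forces (moves S \<omega>) q (\<lambda>r. r = q) i v"
  unfolding misere_win_def by (rule can_force_iff_forces) (rule finite_moves)

lemma stopper_win_iff:
  fixes \<omega> :: "'c::finite sample"
  shows "stopper_win (moves S \<omega>) i v \<longleftrightarrow> forces (moves S \<omega>) P1 (\<lambda>_. True) i v"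
  using can_force_iff_forces[of "moves S \<omega>" P1 i v "\<lambda>_. True"]
  by (simp add: stopper_win_def finite_moves)

lemma outcome_probs:
  fixes chi :: "'c::finite \<Rightarrow> ('c \<Rightarrow> nat) pmf"
  shows "nw p chi S i j = forced_prob chi S i (\<lambda>r. r = opponent i) i j"
    and "nl p chi S i j = forced_prob chi S (opponent i) (\<lambda>r. r = i) i j"
    and "mw p chi S i j = forced_prob chi S i (\<lambda>r. r = i) i j"
    and "ml p chi S i j = forced_prob chi S (opponent i) (\<lambda>r. r = opponent i) i j"
    and "esw p chi S j = forced_prob chi S P1 (\<lambda>_. True) P1 j"
    and "eel p chi S j = forced_prob chi S P1 (\<lambda>_. True) P2 j"
  unfolding nw_def nl_def mw_def ml_def esw_def eel_def forced_prob_def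
    normal_win_iff misere_win_iff stopper_win_iff
  by (simp_all add: root_prob_eq_rooted_prob pred_forces)

lemma alpha_beta_childless:
  fixes chi :: "'c::finite \<Rightarrow> ('c \<Rightarrow> nat) pmf"
  shows "alpha p chi S j = childless (chi j) (allowed S P1 j)"
    and "beta p chi S j = childless (chi j) (allowed S P2 j)"
  unfolding alpha_def beta_def
  by (simp_all add: root_prob_eq_rooted_prob pred_no_children rooted_prob_no_children)

section \<open>Bounds and comparisons\<close>

text \<open>
  Since \<open>u \<ge> e\<close> on \<open>T\<close>, the constant point \<open>1 - e\<close> lies above \<open>1 - u\<close>. The tangent at \<open>1 - u\<close> is
  therefore at most the increment of the generating function up to \<open>1 - e\<close>, whose value there is
  controlled by the probability of having no child in \<open>T\<close>.
\<close>

lemma mover_value_lower_bound: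
  fixes chi :: "'c::finite \<Rightarrow> ('c \<Rightarrow> nat) pmf"
  assumes diff: "gen_fun chi j T differentiable_on unit_cube" and T: "T \<noteq> {}"
    and u: "\<And>k. 0 \<le> u k \<and> u k \<le> 1"
    and v: "v = 1 - pgf (chi j) T (\<lambda>k. 1 - u k) + childless (chi j) T"
    and e: "e = Min (u ` T)"
  shows "childless (chi j) T + e * (1 - childless (chi j) T) +
      (\<Sum>k\<in>T. (u k - e) * partial k (gen_fun chi j T) (\<chi> t. 1 - u t)) \<le> v" (is "?B \<le> v")
    and "e \<le> childless (chi j) T + e * (1 - childless (chi j) T) +
      (\<Sum>k\<in>T. (u k - e) * partial k (gen_fun chi j T) (\<chi> t. 1 - u t))"
proof -
  let ?G = "gen_fun chi j T" and ?a = "childless (chi j) T"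
  let ?x = "\<chi> t. 1 - u t" and ?y = "(\<chi> t. 1 - e) :: real ^ 'c"
  have "e \<in> u ` T"
    unfolding e using T by (intro Min_in) auto
  then have e01: "0 \<le> e" "e \<le> 1"
    using u by auto
  have le: "e \<le> u k" if "k \<in> T" for k
    using that by (simp add: e)
  have xy: "?x \<in> unit_cube" "?y \<in> unit_cube"
    using u e01 by (auto simp: unit_cube_def)
  have "(\<Sum>k\<in>T. (u k - e) * partial k ?G ?x) \<le> ?G ?y - ?G ?x"
    using gen_fun_tangent[OF diff xy] le by simp
  also have "\<dots> = pgf (chi j) T (\<lambda>_. 1 - e) - pgf (chi j) T (\<lambda>k. 1 - u k)"
    using xy by (simp add: gen_fun_eq_pgf pgf_def)
  also have "\<dots> \<le> 1 - e * (1 - ?a) - pgf (chi j) T (\<lambda>k. 1 - u k)"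
    using pgf_constant_le[OF e01, of "chi j" T] by simp
  finally show "?B \<le> v"
    by (simp add: v)
  have "0 \<le> (\<Sum>k\<in>T. (u k - e) * partial k ?G ?x)"
    using le by (intro sum_nonneg mult_nonneg_nonneg partial_gen_fun_nonneg[OF diff xy(1)]) auto
  moreover have "e * 1 \<le> ?a + e * (1 - ?a)"
    using mult_right_mono[of e 1 ?a] e01 by (simp add: algebra_simps)
  ultimately show "e \<le> ?B"
    by simp
qed

lemma forced_prob_mover_bounds:
  fixes chi :: "'c::finite \<Rightarrow> ('c \<Rightarrow> nat) pmf"
  assumes "gen_fun chi j (allowed S q j) differentiable_on unit_cube"
    and "allowed S q j \<noteq> {}" and "A q"
  defines "u \<equiv> forced_prob chi S q A (opponent q)"
  defines "e \<equiv> Min (u ` allowed S q j)"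
  defines "bound \<equiv> childless (chi j) (allowed S q j) + e * (1 - childless (chi j) (allowed S q j)) +
      (\<Sum>k\<in>allowed S q j. (u k - e) * partial k (gen_fun chi j (allowed S q j)) (\<chi> t. 1 - u t))"
  shows "bound \<le> forced_prob chi S q A q j" and "e \<le> bound"
  unfolding bound_def
  by (rule mover_value_lower_bound[OF assms(1,2)];
      use assms(3) forced_prob_mover[of chi S q A j] in \<open>simp add: u_def e_def\<close>)+

text \<open>
  The right-hand side of the hypothesis is the probability that player \<open>i\<close> has exactly one move at the
  root and that this move leaves the opponent stuck, which turns a normal win into a misere loss.
  The converse change, from a normal loss to a misere win, comes from player \<open>i\<close> being
  stuck at the root, and by hypothesis this is not the likelier event.
\<close>

lemma nl_le_ml:
  fixes chi :: "'c::finite \<Rightarrow> ('c \<Rightarrow> nat) pmf"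
  assumes few: "\<And>j. childless (chi j) (allowed S i j) \<le>
      (\<Sum>k\<in>allowed S i j. childless (chi k) (allowed S (opponent i) k) *
         measure_pmf.prob (chi j) {X. X k = 1 \<and> (\<forall>l\<in>allowed S i j - {k}. X l = 0)})"
  shows "nl p chi S i j \<le> ml p chi S i j"
proof -
  define o' where "o' = opponent i"
  let ?nl = "\<lambda>n. forced_prob_in chi S o' (\<lambda>r. r = i) n i"
  let ?nw = "\<lambda>n. forced_prob_in chi S o' (\<lambda>r. r = i) n o'"
  let ?ml = "forced_prob chi S o' (\<lambda>r. r = o') i"
  let ?mw = "forced_prob chi S o' (\<lambda>r. r = o') o'"
  have o': "opponent o' = i" "o' \<noteq> i" "i \<noteq> o'"
    by (simp_all add: o'_def)
  have "?nl (2 * n) j \<le> ?ml j" for n j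
  proof (induction n arbitrary: j)
    case (Suc n)
    let ?T = "allowed S i j" and ?x = "?nw (Suc (2 * n))"
    \<comment> \<open>After one round: the opponent, now to move, profits from being stuck in misere play.\<close>
    have gain: "childless (chi k) (allowed S o' k) \<le> ?mw k - ?x k" for k
    proof -
      have "pgf (chi k) (allowed S o' k) (\<lambda>l. 1 - ?ml l) \<le>
          pgf (chi k) (allowed S o' k) (\<lambda>l. 1 - ?nl (2 * n) l)"
        using Suc.IH by (intro pgf_mono) auto
      then show ?thesis
        using forced_prob_mover[of chi S o' "\<lambda>r. r = o'" k]
          forced_prob_in_mover[of chi S o' "\<lambda>r. r = i" "2 * n" k] o' by simp
    qed
    have le: "?x k \<le> ?mw k" for k
      using order_trans[OF measure_nonneg gain] by simp
    note few[of j, folded o'_def]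
    also have "(\<Sum>k\<in>?T. childless (chi k) (allowed S o' k) *
         measure_pmf.prob (chi j) {X. X k = 1 \<and> (\<forall>l\<in>?T - {k}. X l = 0)}) \<le>
       (\<Sum>k\<in>?T. (?mw k - ?x k) *
         measure_pmf.prob (chi j) {X. X k = 1 \<and> (\<forall>l\<in>?T - {k}. X l = 0)})"
      using gain by (intro sum_mono mult_right_mono) auto
    also have "\<dots> \<le> pgf (chi j) ?T ?mw - pgf (chi j) ?T ?x"
      using le by (intro pgf_increment_lower) auto
    finally show ?case
      using forced_prob_responder[of chi S o' "\<lambda>r. r = o'" j]
        forced_prob_in_responder[of chi S o' "\<lambda>r. r = i" "Suc (2 * n)" j] o' by simp
  qed simp
  then show ?thesis
    unfolding outcome_probs o'_def[symmetric] by (intro forced_prob_le)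
qed

text \<open>
  Player \<open>i\<close> gains from misere play by being stuck at the root. What \<open>i\<close> may lose comes from moves that
  leave the opponent stuck, and the left-hand side of the hypothesis is the expected number of such
  moves at the root.
\<close>

lemma nw_le_mw:
  fixes chi :: "'c::finite \<Rightarrow> ('c \<Rightarrow> nat) pmf"
  assumes many: "\<And>j. (\<Sum>k\<in>allowed S i j. ennreal (childless (chi k) (allowed S (opponent i) k)) *
         (\<integral>\<^sup>+X. ennreal (real (X k)) \<partial>measure_pmf (chi j)))
      \<le> ennreal (childless (chi j) (allowed S i j))"
  shows "nw p chi S i j \<le> mw p chi S i j"
proof -
  define o' where "o' = opponent i"
  let ?nw = "\<lambda>n. forced_prob_in chi S i (\<lambda>r. r = o') n i"
  let ?nl = "\<lambda>n. forced_prob_in chi S i (\<lambda>r. r = o') n o'"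
  let ?mw = "forced_prob chi S i (\<lambda>r. r = i) i"
  let ?ml = "forced_prob chi S i (\<lambda>r. r = i) o'"
  have o': "opponent i = o'" "o' \<noteq> i" "i \<noteq> o'"
    by (simp_all add: o'_def)
  have "?nw (2 * n) j \<le> ?mw j" for n j
  proof (induction n arbitrary: j)
    case (Suc n)
    let ?T = "allowed S i j" and ?x = "?nl (Suc (2 * n))"
    \<comment> \<open>After one round: the opponent, now to move, escapes defeat in misere play by being stuck.\<close>
    have loss: "1 - ?ml k \<le> (1 - ?x k) + childless (chi k) (allowed S o' k)" for k
    proof -
      have "pgf (chi k) (allowed S o' k) (?nw (2 * n)) \<le> pgf (chi k) (allowed S o' k) ?mw"
        using Suc.IH by (intro pgf_mono) auto
      then show ?thesis
        using forced_prob_responder[of chi S i "\<lambda>r. r = i" k]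
          forced_prob_in_responder[of chi S i "\<lambda>r. r = o'" "2 * n" k] o' by simp
    qed
    have nonneg: "0 \<le> pgf (chi j) ?T (\<lambda>k. 1 - ?x k)"
      unfolding pgf_def by (intro integral_nonneg_AE AE_I2 monomial_bounds) auto
    have "ennreal (pgf (chi j) ?T (\<lambda>k. 1 - ?ml k)) \<le> ennreal (pgf (chi j) ?T (\<lambda>k. 1 - ?x k)) +
        (\<Sum>k\<in>?T. ennreal (childless (chi k) (allowed S o' k)) *
           (\<integral>\<^sup>+X. ennreal (real (X k)) \<partial>measure_pmf (chi j)))"
      using loss by (intro pgf_increment_upper) auto
    also have "\<dots> \<le> ennreal (pgf (chi j) ?T (\<lambda>k. 1 - ?x k)) + ennreal (childless (chi j) ?T)"
      using many[of j] unfolding o'_def[symmetric] by (intro add_left_mono)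
    finally have "pgf (chi j) ?T (\<lambda>k. 1 - ?ml k) \<le>
        pgf (chi j) ?T (\<lambda>k. 1 - ?x k) + childless (chi j) ?T"
      using nonneg by (simp flip: ennreal_plus)
    then show ?case
      using forced_prob_mover[of chi S i "\<lambda>r. r = i" j]
        forced_prob_in_mover[of chi S i "\<lambda>r. r = o'" "Suc (2 * n)" j] o' by simp
  qed simp
  then show ?thesis
    unfolding outcome_probs o'_def[symmetric] by (intro forced_prob_le)
qed

theorem theorem1p6:
  fixes p :: "'c::finite pmf"
    and chi :: "'c \<Rightarrow> ('c \<Rightarrow> nat) pmf"
    and S :: "'c \<Rightarrow> 'c set"
  assumes "\<And>j. S j \<noteq> {}" and "\<And>j. S j \<noteq> UNIV"
  shows
    "(\<forall>j. nw p chi S P1 j \<le> esw p chi S j \<and> nl p chi S P2 j \<le> eel p chi S j \<and>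
          mw p chi S P1 j \<le> esw p chi S j \<and> ml p chi S P2 j \<le> eel p chi S j)
   \<and>
     ((\<forall>j. gen_fun chi j (S j) differentiable_on unit_cube \<and>
           gen_fun chi j (UNIV - S j) differentiable_on unit_cube) \<longrightarrow>
      (\<forall>j. let e = Min (eel p chi S ` S j);
               a = Min (ml p chi S P2 ` S j);
               c = Min (ml p chi S P1 ` (UNIV - S j));
               lower_es = alpha p chi S j + e * (1 - alpha p chi S j) +
                 (\<Sum>k\<in>S j. (eel p chi S k - e) *
                    partial k (gen_fun chi j (S j)) (\<chi> t. 1 - eel p chi S t));
               lower_mw1 = alpha p chi S j + a * (1 - alpha p chi S j) +
                 (\<Sum>k\<in>S j. (ml p chi S P2 k - a) *
                    partial k (gen_fun chi j (S j)) (\<chi> t. 1 - ml p chi S P2 t));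
               lower_mw2 = beta p chi S j + c * (1 - beta p chi S j) +
                 (\<Sum>k\<in>UNIV - S j. (ml p chi S P1 k - c) *
                    partial k (gen_fun chi j (UNIV - S j)) (\<chi> t. 1 - ml p chi S P1 t))
           in esw p chi S j \<ge> lower_es \<and> lower_es \<ge> e \<and>
              mw p chi S P1 j \<ge> lower_mw1 \<and> lower_mw1 \<ge> a \<and>
              mw p chi S P2 j \<ge> lower_mw2 \<and> lower_mw2 \<ge> c))
   \<and>
     ((\<forall>j. convex_on unit_cube (gen_fun chi j (S j)) \<and>
           C1_on_cube (S j) (gen_fun chi j (S j)) \<and>
           continuous_on unit_cube (gen_fun chi j (UNIV - S j))) \<longrightarrow>
      ((\<forall>j. alpha p chi S j \<le>
            (\<Sum>i\<in>S j. beta p chi S i *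
               measure_pmf.prob (chi j) {X. X i = 1 \<and> (\<forall>k\<in>S j - {i}. X k = 0)})) \<longrightarrow>
       (\<forall>j. nl p chi S P1 j \<le> ml p chi S P1 j)) \<and>
      ((\<forall>j. ennreal (alpha p chi S j) \<ge>
            (\<Sum>i\<in>S j. ennreal (beta p chi S i) *
               (\<integral>\<^sup>+X. ennreal (real (X i)) \<partial>measure_pmf (chi j)))) \<longrightarrow>
       (\<forall>j. nw p chi S P1 j \<le> mw p chi S P1 j)))
   \<and>
     ((\<forall>j. convex_on unit_cube (gen_fun chi j (UNIV - S j)) \<and>
           C1_on_cube (UNIV - S j) (gen_fun chi j (UNIV - S j)) \<and>
           continuous_on unit_cube (gen_fun chi j (S j))) \<longrightarrow>
      ((\<forall>j. beta p chi S j \<le>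
            (\<Sum>i\<in>UNIV - S j. alpha p chi S i *
               measure_pmf.prob (chi j) {X. X i = 1 \<and> (\<forall>k\<in>(UNIV - S j) - {i}. X k = 0)})) \<longrightarrow>
       (\<forall>j. nl p chi S P2 j \<le> ml p chi S P2 j)) \<and>
      ((\<forall>j. ennreal (beta p chi S j) \<ge>
            (\<Sum>i\<in>UNIV - S j. ennreal (alpha p chi S i) *
               (\<integral>\<^sup>+X. ennreal (real (X i)) \<partial>measure_pmf (chi j)))) \<longrightarrow>
       (\<forall>j. nw p chi S P2 j \<le> mw p chi S P2 j)))"
proof -
  have dom: "nw p chi S P1 j \<le> esw p chi S j \<and> nl p chi S P2 j \<le> eel p chi S j \<and>
          mw p chi S P1 j \<le> esw p chi S j \<and> ml p chi S P2 j \<le> eel p chi S j" for j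
    by (auto simp: outcome_probs intro!: forced_prob_mono)
  have eqs: "eel p chi S = forced_prob chi S P1 (\<lambda>_. True) P2"
      "esw p chi S = forced_prob chi S P1 (\<lambda>_. True) P1"
      "ml p chi S P2 = forced_prob chi S P1 (\<lambda>r. r = P1) P2"
      "mw p chi S P1 = forced_prob chi S P1 (\<lambda>r. r = P1) P1"
      "ml p chi S P1 = forced_prob chi S P2 (\<lambda>r. r = P2) P1"
      "mw p chi S P2 = forced_prob chi S P2 (\<lambda>r. r = P2) P2"
    by (simp_all add: outcome_probs fun_eq_iff)
  have bounds: "let e = Min (eel p chi S ` S j);
          a = Min (ml p chi S P2 ` S j);
          c = Min (ml p chi S P1 ` (UNIV - S j));
          lower_es = alpha p chi S j + e * (1 - alpha p chi S j) +
            (\<Sum>k\<in>S j. (eel p chi S k - e) *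
               partial k (gen_fun chi j (S j)) (\<chi> t. 1 - eel p chi S t));
          lower_mw1 = alpha p chi S j + a * (1 - alpha p chi S j) +
            (\<Sum>k\<in>S j. (ml p chi S P2 k - a) *
               partial k (gen_fun chi j (S j)) (\<chi> t. 1 - ml p chi S P2 t));
          lower_mw2 = beta p chi S j + c * (1 - beta p chi S j) +
            (\<Sum>k\<in>UNIV - S j. (ml p chi S P1 k - c) *
               partial k (gen_fun chi j (UNIV - S j)) (\<chi> t. 1 - ml p chi S P1 t))
      in esw p chi S j \<ge> lower_es \<and> lower_es \<ge> e \<and>
         mw p chi S P1 j \<ge> lower_mw1 \<and> lower_mw1 \<ge> a \<and>
         mw p chi S P2 j \<ge> lower_mw2 \<and> lower_mw2 \<ge> c"
    if "\<forall>j. gen_fun chi j (S j) differentiable_on unit_cube \<and>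
           gen_fun chi j (UNIV - S j) differentiable_on unit_cube" for j
  proof -
    have d: "gen_fun chi j (allowed S q j) differentiable_on unit_cube" for q
      using that by (cases q) auto
    have ne: "allowed S q j \<noteq> {}" for q
      using assms(1)[of j] assms(2)[of j] by (cases q) auto
    show ?thesis
      unfolding Let_def eqs alpha_beta_childless
      using forced_prob_mover_bounds[of chi j S P1 "\<lambda>_. True", OF d ne]
        forced_prob_mover_bounds[of chi j S P1 "\<lambda>r. r = P1", OF d ne]
        forced_prob_mover_bounds[of chi j S P2 "\<lambda>r. r = P2", OF d ne]
      unfolding allowed.simps opponent.simps by blast
  qed
  have nl1: "nl p chi S P1 j \<le> ml p chi S P1 j"
    if "\<forall>j. alpha p chi S j \<le> (\<Sum>i\<in>S j. beta p chi S i *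
          measure_pmf.prob (chi j) {X. X i = 1 \<and> (\<forall>k\<in>S j - {i}. X k = 0)})" for j
    using that by (intro nl_le_ml) (simp add: alpha_beta_childless)
  have nl2: "nl p chi S P2 j \<le> ml p chi S P2 j"
    if "\<forall>j. beta p chi S j \<le> (\<Sum>i\<in>UNIV - S j. alpha p chi S i *
          measure_pmf.prob (chi j) {X. X i = 1 \<and> (\<forall>k\<in>(UNIV - S j) - {i}. X k = 0)})" for j
    using that by (intro nl_le_ml) (simp add: alpha_beta_childless)
  have nw1: "nw p chi S P1 j \<le> mw p chi S P1 j"
    if "\<forall>j. ennreal (alpha p chi S j) \<ge> (\<Sum>i\<in>S j. ennreal (beta p chi S i) *
          (\<integral>\<^sup>+X. ennreal (real (X i)) \<partial>measure_pmf (chi j)))" for j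
    using that by (intro nw_le_mw) (simp add: alpha_beta_childless)
  have nw2: "nw p chi S P2 j \<le> mw p chi S P2 j"
    if "\<forall>j. ennreal (beta p chi S j) \<ge> (\<Sum>i\<in>UNIV - S j. ennreal (alpha p chi S i) *
          (\<integral>\<^sup>+X. ennreal (real (X i)) \<partial>measure_pmf (chi j)))" for j
    using that by (intro nw_le_mw) (simp add: alpha_beta_childless)
  show ?thesis
    by (intro conjI impI; rule allI)
      (rule dom | (rule bounds nl1 nl2 nw1 nw2; assumption))+
qed

end
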